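(* Let $b\ge3$, let $l\in\mathbb{J}=\{1,\dots,b-2\}$, let $h_l$ be the corresponding dividing curve in the pants decomposition of $S_{b+1}$, and let $f_l$ be a simple closed curve which intersects $h_l$ twice and is disjoint from the other dividing curves $h_k$, $k\neq l$ (all curves being realized by closed geodesics; $f_l$ also denotes an element of $G_b$ representing the curve). Let $\mathbf u=\mathbf u_0+\sum_{k=1}^{b-2}t_k\,{\rm AT}_k$ with $\mathbf u_0\in L_0(D_b^0)$ and $t_1,\dots,t_{b-2}\in\mathbb{R}$. Then $$\frac12\,\frac{dL^{\mathbf u}_{f_l}}{dt}(0)=\alpha_{\mathbf u_0}(f_l)+t_l\,(\cos\theta_l+\cos\theta_l'),$$ where $\theta_l,\theta_l'$ are the angles between $h_l$ and $f_l$ in $S_{b+1}$ at the two intersection points.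
   Context: Lorentzian space: $\mathbb{R}^2_1$ is $\mathbb{R}^3$ with $B(\mathbf x,\mathbf y)=x_1y_1+x_2y_2-x_3y_3$; $SO^0(2,1)\cong {\rm PSL}(2,\mathbb{R})$ is the identity component of its isometry group. A hyperbolic $g\in SO^0(2,1)$ has three distinct eigenvalues $\lambda_g<1<\lambda_g^{-1}$ ($0<\lambda_g<1$). Its normalized eigenvectors: $\mathbf X_g^-$ (eigenvalue $\lambda_g$) and $\mathbf X_g^+$ (eigenvalue $\lambda_g^{-1}$), null, future-pointing, Euclidean length $1$; $\mathbf X_g^0$ (eigenvalue $1$) with $B(\mathbf X_g^0,\mathbf X_g^0)=1$, $\det(\mathbf X_g^0,\mathbf X_g^-,\mathbf X_g^+)>0$. The hyperbolic plane $\mathbb{H}^2$ is the set of future-pointing unit timelike vectors. Group: for $b\ge 3$, $S_{b+1}$ is a sphere with $b+1$ boundary components. Fix a discrete faithful representation $\pi_1(S_{b+1})\to {\rm PSL}(2,\mathbb{R})\cong SO^0(2,1)$ with image $G_b$ such that $\mathbb{H}^2/G_b\cong S_{b+1}$ and all peripheral curves are sent to hyperbolic elements. Write $G_b=\langle g_1,\dots,g_{b+1}\mid g_1g_2\cdots g_{b+1}=id\rangle$, each $g_i$ corresponding to a boundary component, with $B(\mathbf X^0_{g_m},\mathbf X^0_{g_n})<-1$ and $B(\mathbf X^0_{g_m},\mathbf X^{\pm}_{g_n})<0$ for $m\ne n$. Put $\mathbb{I}=\{1,\dots,b+1\}$, $\mathbb{J}=\{1,\dots,b-2\}$, $h_j=g_{j+1}^{-1}g_j^{-1}\cdots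 g_1^{-1}$ for $j\in\mathbb{J}$; the closed geodesics of the $h_j$ are the dividing curves of a pants decomposition of $S_{b+1}$ with pants subgroups $P_1=\langle g_1,g_2,h_1\rangle$, $P_j=\langle h_{j-1},g_{j+1},h_j\rangle$ for $2\le j\le b-2$, $P_{b-1}=\langle h_{b-2},g_b,g_{b+1}\rangle$. We also call $P_j$ the corresponding pair of pants in $S_{b+1}$; $P_l$ and $P_{l+1}$ are the two pairs of pants adjacent along $h_l$. Write $\mathbf X_i^{0,\pm}=\mathbf X_{g_i}^{0,\pm}$, $\mathbf Y_j^0=\mathbf X^0_{h_j}$. Cocycles: a cocycle is a map $\mathbf u:G_b\to\mathbb{R}^2_1$ with $\mathbf u(gh)=g\mathbf u(h)+\mathbf u(g)$; the coboundary of $\mathbf v$ is $\delta_{\mathbf v}(g)=\mathbf v-g\mathbf v$. The Margulis invariant is $\alpha_{\mathbf u}(g)=B(\mathbf u(g),\mathbf X_g^0)$. $D_b^0=\{(\alpha,\beta,\mathbf 0)\mid \alpha\in\mathbb{R}^{\mathbb I},\beta\in\mathbb{R}^{\mathbb J}\}$, and $L_0(\alpha,\beta,\mathbf 0)=\mathbf u_0^{\alpha,\beta}$ is the unique cocycle $\mathbf w$ on $G_b$ with $\alpha_{\mathbf w}(g_i)=\alpha_i$ ($i\in\mathbb I$), $\alpha_{\mathbf w}(h_j)=\beta_j$ ($j\in\mathbb J$) and, writing $\mathbf w(g_i)=\alpha_i\mathbf X_i^0+c_i^-\mathbf X_i^-+c_i^+\mathbf X_i^+$, with $c_1^-=c_1^+=0$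 and $c_i^-=0$ for $2\le i\le b$. The affine twist ${\rm AT}_k$ ($k\in\mathbb J$) is the cocycle on $G_b$ determined by ${\rm AT}_k|_{P_m}=\mathbf 0$ for $1\le m\le k$ and ${\rm AT}_k|_{P_m}=\delta_{\mathbf Y_k^0}|_{P_m}$ for $k+1\le m\le b-1$. Length function: let $\psi:sl_2(\mathbb{R})\to\mathbb{R}^2_1$, $\psi\begin{pmatrix} v_1 & v_2 \\ v_3 & -v_1 \end{pmatrix}=\left(v_1,\tfrac{v_2+v_3}{2},\tfrac{-v_2+v_3}{2}\right)$, an isometry from the form $\tfrac12{\rm tr}(\mathbf X\mathbf Y)$ to $B$; through $\psi$ the adjoint action identifies ${\rm PSL}(2,\mathbb{R})$ with $SO^0(2,1)$. For $g\in G_b$ let $\widetilde g\in SL(2,\mathbb{R})$ be a lift of the corresponding element. For hyperbolic $A\in SL(2,\mathbb{R})$ with eigenvalue $\pm\mu$, $0<\mu<1$, put $\ell(A)=-2\log\mu$. Regarding $\mathbf u(g)$ as an element of $sl_2(\mathbb{R})$ via $\psi$, set $L_g^{\mathbf u}(t)=\ell\big(\widetilde g\exp(t\,\mathbf u(g)+O(t^2))\big)$ for $t$ near $0$. Angles: orient $h_l$ by the translation direction of the element $h_l$ and $f_l$ by that of the element $f_l$. $\theta_l\in(0,\pi)$ is the angle between the forward tangent vectors of $h_l$ and $f_l$ at the intersection point where $f_l$ passes from $P_l$ into $P_{l+1}$; $\theta_l'\in(0,\pi)$ is $\pi$ minus the angle between the forward tangent vectors of $h_l$ and $f_l$ at the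 other intersection point, where $f_l$ passes from $P_{l+1}$ into $P_l$. *)

theory Defs
  imports "HOL-Analysis.Analysis" "HOL-Library.Landau_Symbols"
begin

section \<open>Lorentzian space and hyperbolic isometries\<close>

definition B :: "real^3 \<Rightarrow> real^3 \<Rightarrow> real" where
  "B x y = x$1 * y$1 + x$2 * y$2 - x$3 * y$3"

definition H2 :: "(real^3) set" where
  "H2 = {x. B x x = -1 \<and> x$3 > 0}"

definition SO0 :: "(real^3^3) set" where
  "SO0 = connected_component_set {A. \<forall>x y. B (A *v x) (A *v y) = B x y} (mat 1)"

definition is_eigenvalue :: "real^'n^'n \<Rightarrow> real \<Rightarrow> bool" where
  "is_eigenvalue A c \<longleftrightarrow> (\<exists>v. v \<noteq> 0 \<and> A *v v = c *\<^sub>R v)"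

definition hyperbolic :: "real^3^3 \<Rightarrow> bool" where
  "hyperbolic A \<longleftrightarrow> A \<in> SO0 \<and>
     (\<exists>c. 0 < c \<and> c < 1 \<and> is_eigenvalue A c \<and> is_eigenvalue A 1 \<and> is_eigenvalue A (inverse c))"

definition lam :: "real^3^3 \<Rightarrow> real" where
  "lam A = (THE c. 0 < c \<and> c < 1 \<and> is_eigenvalue A c)"

definition Xminus :: "real^3^3 \<Rightarrow> real^3" where
  "Xminus A = (THE x. A *v x = lam A *\<^sub>R x \<and> B x x = 0 \<and> x$3 > 0 \<and> norm x = 1)"

definition Xplus :: "real^3^3 \<Rightarrow> real^3" where
  "Xplus A = (THE x. A *v x = inverse (lam A) *\<^sub>R x \<and> B x x = 0 \<and> x$3 > 0 \<and> norm x = 1)"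

definition Xzero :: "real^3^3 \<Rightarrow> real^3" where
  "Xzero A = (THE x. A *v x = x \<and> B x x = 1 \<and>
     det (vector [x, Xminus A, Xplus A] :: real^3^3) > 0)"

definition axis_of :: "real^3^3 \<Rightarrow> (real^3) set" where
  "axis_of A = H2 \<inter> span {Xminus A, Xplus A}"

text \<open>The unit tangent vector at \<open>x\<close> of the geodesic of \<open>H2\<close> from \<open>x\<close> to \<open>y\<close>. For \<open>x\<close> on the axis
  of a hyperbolic \<open>A\<close>, the forward tangent vector of the axis points from \<open>x\<close> to \<open>A *v x\<close>.\<close>

definition toward :: "real^3 \<Rightarrow> real^3 \<Rightarrow> real^3" where
  "toward x y = (1 / sqrt ((B x y)\<^sup>2 - 1)) *\<^sub>R (y + B x y *\<^sub>R x)"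

definition forward_tangent :: "real^3^3 \<Rightarrow> real^3 \<Rightarrow> real^3" where
  "forward_tangent A x = toward x (A *v x)"

definition geodesic :: "real^3 \<Rightarrow> real^3 \<Rightarrow> real \<Rightarrow> real^3" where
  "geodesic x v s = cosh s *\<^sub>R x + sinh s *\<^sub>R v"

definition axis_angle :: "real^3^3 \<Rightarrow> real^3^3 \<Rightarrow> real^3 \<Rightarrow> real" where
  "axis_angle A A' x = arccos (B (forward_tangent A x) (forward_tangent A' x))"


section \<open>Groups of isometries and closed geodesics of the quotient\<close>

definition generated :: "(real^3^3) set \<Rightarrow> (real^3^3) set" where
  "generated S = (\<lambda>H. mat 1 \<in> H \<and> (\<forall>A\<in>H. \<forall>A'\<in>H. A ** A' \<in> H) \<and> (\<forall>A\<in>H. matrix_inv A \<in> H)) hull S"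

text \<open>A point of the quotient \<open>H2 / \<Gamma>\<close> is the orbit of a point of \<open>H2\<close>.\<close>

definition orbit :: "(real^3^3) set \<Rightarrow> real^3 \<Rightarrow> (real^3) set" where
  "orbit \<Gamma> x = (\<lambda>A. A *v x) ` \<Gamma>"

definition closed_geodesic :: "(real^3^3) set \<Rightarrow> real^3^3 \<Rightarrow> (real^3) set set" where
  "closed_geodesic \<Gamma> A = orbit \<Gamma> ` axis_of A"

text \<open>The closed geodesic \<open>axis_of A / \<langle>A\<rangle> \<rightarrow> H2 / \<Gamma>\<close> is injective; in particular it is
  traversed only once by \<open>A\<close>.\<close>

definition simple_closed_geodesic :: "(real^3^3) set \<Rightarrow> real^3^3 \<Rightarrow> bool" where
  "simple_closed_geodesic \<Gamma> A \<longleftrightarrow> hyperbolic A \<and>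
     (\<forall>x\<in>axis_of A. \<forall>C\<in>\<Gamma>. C *v x \<in> axis_of A \<longrightarrow> C \<in> generated {A})"

text \<open>\<open>X / \<Gamma>\<close>, with the quotient topology, is homeomorphic to a sphere with \<open>n\<close> points removed,
  that is, to the interior of a sphere with \<open>n\<close> boundary components.\<close>

definition quotient_is_holed_sphere :: "(real^3) set \<Rightarrow> (real^3^3) set \<Rightarrow> nat \<Rightarrow> bool" where
  "quotient_is_holed_sphere X \<Gamma> n \<longleftrightarrow>
     (\<exists>F p. F \<subseteq> sphere (0::real^3) 1 \<and> finite F \<and> card F = n \<and>
        quotient_map (top_of_set X) (top_of_set (sphere (0::real^3) 1 - F)) p \<and>
        (\<forall>x\<in>X. \<forall>y\<in>X. p x = p y \<longleftrightarrow> (\<exists>C\<in>\<Gamma>. C *v x = y)))"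


section \<open>The presentation of the surface group\<close>

text \<open>The letter \<open>(i, True)\<close> stands for the \<open>i\<close>-th generator, \<open>(i, False)\<close> for its inverse. Two words
  are related if they represent the same element of the group presented by
  \<open>\<langle>x\<^sub>1, \<dots>, x\<^sub>n | x\<^sub>1 \<cdots> x\<^sub>n\<rangle>\<close>.\<close>

definition relator :: "nat \<Rightarrow> (nat \<times> bool) list" where
  "relator n = map (\<lambda>i. (i, True)) [1..<Suc n]"

inductive word_eq :: "nat \<Rightarrow> (nat \<times> bool) list \<Rightarrow> (nat \<times> bool) list \<Rightarrow> bool" for n where
  refl: "word_eq n v v"
| sym: "word_eq n v w \<Longrightarrow> word_eq n w v"
| trans: "word_eq n v w \<Longrightarrow> word_eq n w z \<Longrightarrow> word_eq n v z"
| cancel: "i \<in> {1..n} \<Longrightarrow> word_eq n (v @ [(i, e), (i, \<not> e)] @ w) (v @ w)"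
| relation: "word_eq n (v @ relator n @ w) (v @ w)"

definition word_eval :: "(nat \<Rightarrow> real^3^3) \<Rightarrow> (nat \<times> bool) list \<Rightarrow> real^3^3" where
  "word_eval g w = foldr (\<lambda>(i, e) M. (if e then g i else matrix_inv (g i)) ** M) w (mat 1)"

definition presented :: "nat \<Rightarrow> (nat \<Rightarrow> real^3^3) \<Rightarrow> bool" where
  "presented n g \<longleftrightarrow> (\<forall>w. set w \<subseteq> {1..n} \<times> UNIV \<longrightarrow> (word_eval g w = mat 1 \<longleftrightarrow> word_eq n w []))"

definition Gb :: "nat \<Rightarrow> (nat \<Rightarrow> real^3^3) \<Rightarrow> (real^3^3) set" where
  "Gb b g = generated (g ` {1..b+1})"

text \<open>The \<open>g i\<close> correspond to the boundary components of the surface: one of the two sides \<open>E i\<close> of the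
  axis of \<open>g i\<close> has stabilizer \<open>\<langle>g i\<rangle>\<close> and is disjoint from its other translates, so that it covers
  an annulus between the closed geodesic of \<open>g i\<close> and an end of \<open>H2 / Gb b g\<close>; for distinct \<open>i\<close>
  these annuli are disjoint.\<close>

definition boundary_elements :: "nat \<Rightarrow> (nat \<Rightarrow> real^3^3) \<Rightarrow> bool" where
  "boundary_elements b g \<longleftrightarrow>
     (\<exists>E. (\<forall>i\<in>{1..b+1}. E i \<in> components (H2 - axis_of (g i))) \<and>
        (\<forall>i\<in>{1..b+1}. \<forall>j\<in>{1..b+1}. \<forall>C\<in>Gb b g.
           ((\<lambda>x. C *v x) ` E i) \<inter> E j \<noteq> {} \<longrightarrow> i = j \<and> C \<in> generated {g i}))"

definition surface_group :: "nat \<Rightarrow> (nat \<Rightarrow> real^3^3) \<Rightarrow> bool" where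
  "surface_group b g \<longleftrightarrow>
     (\<forall>i\<in>{1..b+1}. hyperbolic (g i)) \<and>
     discrete (Gb b g) \<and>
     presented (b+1) g \<and>
     quotient_is_holed_sphere H2 (Gb b g) (b+1) \<and>
     boundary_elements b g \<and>
     (\<forall>m\<in>{1..b+1}. \<forall>n\<in>{1..b+1}. m \<noteq> n \<longrightarrow>
        B (Xzero (g m)) (Xzero (g n)) < -1 \<and>
        B (Xzero (g m)) (Xplus (g n)) < 0 \<and> B (Xzero (g m)) (Xminus (g n)) < 0)"


section \<open>The pants decomposition\<close>

text \<open>\<open>hcurve g j\<close> is \<open>g\<^bsub>j+1\<^esub>\<^bsup>-1\<^esup> g\<^bsub>j\<^esub>\<^bsup>-1\<^esup> \<cdots> g\<^bsub>1\<^esub>\<^bsup>-1\<^esup>\<close>.\<close>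

primrec hcurve :: "(nat \<Rightarrow> real^3^3) \<Rightarrow> nat \<Rightarrow> real^3^3" where
  "hcurve g 0 = matrix_inv (g 1)"
| "hcurve g (Suc j) = matrix_inv (g (Suc (Suc j))) ** hcurve g j"

definition pants_group :: "nat \<Rightarrow> (nat \<Rightarrow> real^3^3) \<Rightarrow> nat \<Rightarrow> (real^3^3) set" where
  "pants_group b g m =
     (if m = 1 then generated {g 1, g 2, hcurve g 1}
      else if m = b - 1 then generated {hcurve g (b-2), g b, g (b+1)}
      else generated {hcurve g (m-1), g (m+1), hcurve g m})"

definition dividing_lifts :: "nat \<Rightarrow> (nat \<Rightarrow> real^3^3) \<Rightarrow> (real^3) set" where
  "dividing_lifts b g = (\<Union>k\<in>{1..b-2}. \<Union>C\<in>Gb b g. (\<lambda>x. C *v x) ` axis_of (hcurve g k))"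

text \<open>The closed geodesics of the \<open>hcurve g k\<close> cut \<open>H2 / Gb b g\<close> into \<open>b - 1\<close> pairs of pants. The
  \<open>m\<close>-th one is described by its lift \<open>R m\<close>, the component of the complement of all lifts of the
  dividing curves whose stabilizer is \<open>pants_group b g m\<close>.\<close>

definition pants_decomposition :: "nat \<Rightarrow> (nat \<Rightarrow> real^3^3) \<Rightarrow> (nat \<Rightarrow> (real^3) set) \<Rightarrow> bool" where
  "pants_decomposition b g R \<longleftrightarrow>
     (\<forall>k\<in>{1..b-2}. simple_closed_geodesic (Gb b g) (hcurve g k)) \<and>
     (\<forall>k\<in>{1..b-2}. \<forall>k'\<in>{1..b-2}. k \<noteq> k' \<longrightarrow>
        closed_geodesic (Gb b g) (hcurve g k) \<inter> closed_geodesic (Gb b g) (hcurve g k') = {}) \<and>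
     (\<forall>m\<in>{1..b-1}. R m \<in> components (H2 - dividing_lifts b g) \<and>
        {C \<in> Gb b g. (\<lambda>x. C *v x) ` R m = R m} = pants_group b g m \<and>
        quotient_is_holed_sphere (R m) (pants_group b g m) 3) \<and>
     (\<forall>Q\<in>components (H2 - dividing_lifts b g).
        \<exists>!m. m \<in> {1..b-1} \<and> (\<exists>C\<in>Gb b g. Q = (\<lambda>x. C *v x) ` R m))"

text \<open>At \<open>x\<close> the closed geodesic of \<open>A\<close> passes from the image of \<open>Q\<close> in \<open>H2 / \<Gamma>\<close> into that of \<open>Q'\<close>.\<close>

definition passes_at ::
    "(real^3^3) set \<Rightarrow> real^3^3 \<Rightarrow> (real^3) set \<Rightarrow> (real^3) set \<Rightarrow> real^3 \<Rightarrow> bool" where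
  "passes_at \<Gamma> A Q Q' x \<longleftrightarrow> x \<in> axis_of A \<and>
     (\<forall>\<^sub>F s in at_left 0. orbit \<Gamma> (geodesic x (forward_tangent A x) s) \<in> orbit \<Gamma> ` Q) \<and>
     (\<forall>\<^sub>F s in at_right 0. orbit \<Gamma> (geodesic x (forward_tangent A x) s) \<in> orbit \<Gamma> ` Q')"


section \<open>Cocycles\<close>

definition cocycle :: "(real^3^3) set \<Rightarrow> (real^3^3 \<Rightarrow> real^3) \<Rightarrow> bool" where
  "cocycle \<Gamma> u \<longleftrightarrow> (\<forall>A\<in>\<Gamma>. \<forall>A'\<in>\<Gamma>. u (A ** A') = A *v u A' + u A)"

definition coboundary :: "real^3 \<Rightarrow> real^3^3 \<Rightarrow> real^3" where
  "coboundary v A = v - A *v v"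

definition margulis :: "(real^3^3 \<Rightarrow> real^3) \<Rightarrow> real^3^3 \<Rightarrow> real" where
  "margulis u A = B (u A) (Xzero A)"

definition L0_cocycle ::
    "nat \<Rightarrow> (nat \<Rightarrow> real^3^3) \<Rightarrow> (nat \<Rightarrow> real) \<Rightarrow> (nat \<Rightarrow> real) \<Rightarrow> (real^3^3 \<Rightarrow> real^3) \<Rightarrow> bool" where
  "L0_cocycle b g \<alpha> \<beta> w \<longleftrightarrow>
     cocycle (Gb b g) w \<and>
     (\<forall>i\<in>{1..b+1}. margulis w (g i) = \<alpha> i) \<and>
     (\<forall>j\<in>{1..b-2}. margulis w (hcurve g j) = \<beta> j) \<and>
     (\<exists>cm cp. (\<forall>i\<in>{1..b+1}. w (g i) =
           \<alpha> i *\<^sub>R Xzero (g i) + cm i *\<^sub>R Xminus (g i) + cp i *\<^sub>R Xplus (g i)) \<and>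
        cm 1 = 0 \<and> cp 1 = 0 \<and> (\<forall>i\<in>{2..b}. cm i = 0))"

definition affine_twist ::
    "nat \<Rightarrow> (nat \<Rightarrow> real^3^3) \<Rightarrow> nat \<Rightarrow> (real^3^3 \<Rightarrow> real^3) \<Rightarrow> bool" where
  "affine_twist b g k w \<longleftrightarrow>
     cocycle (Gb b g) w \<and>
     (\<forall>m\<in>{1..k}. \<forall>A\<in>pants_group b g m. w A = 0) \<and>
     (\<forall>m\<in>{k+1..b-1}. \<forall>A\<in>pants_group b g m. w A = coboundary (Xzero (hcurve g k)) A)"


section \<open>The length function\<close>

definition sl2 :: "(real^2^2) set" where
  "sl2 = {M. trace M = 0}"

definition psi :: "real^2^2 \<Rightarrow> real^3" where
  "psi M = vector [M$1$1, (M$1$2 + M$2$1) / 2, (- M$1$2 + M$2$1) / 2]"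

definition is_lift :: "real^2^2 \<Rightarrow> real^3^3 \<Rightarrow> bool" where
  "is_lift M A \<longleftrightarrow> det M = 1 \<and> (\<forall>N\<in>sl2. psi (M ** N ** matrix_inv M) = A *v psi N)"

text \<open>The type \<open>real^2^2\<close> carries no library exponential for the matrix product.\<close>

definition matrix_exp :: "real^2^2 \<Rightarrow> real^2^2" where
  "matrix_exp M = (\<Sum>n. (1 / fact n) *\<^sub>R (((\<lambda>N. M ** N) ^^ n) (mat 1)))"

definition ell :: "real^2^2 \<Rightarrow> real" where
  "ell M = - 2 * ln (THE \<mu>. 0 < \<mu> \<and> \<mu> < 1 \<and> (is_eigenvalue M \<mu> \<or> is_eigenvalue M (- \<mu>)))"

text \<open>The length function of the deformation of \<open>A\<close> in the direction \<open>u A\<close>, where \<open>M\<close> is a lift of \<open>A\<close>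
  and \<open>r\<close> is the term of order \<open>t\<^sup>2\<close>.\<close>

definition length_fun ::
    "(real^3^3 \<Rightarrow> real^3) \<Rightarrow> real^3^3 \<Rightarrow> real^2^2 \<Rightarrow> (real \<Rightarrow> real^2^2) \<Rightarrow> real \<Rightarrow> real" where
  "length_fun u A M r t = ell (M ** matrix_exp (t *\<^sub>R inv_into sl2 psi (u A) + r t))"

end

theory Submission
  imports Defs
begin

text \<open>
  Half the derivative of the length is a Margulis invariant. The length of a matrix of determinant \<open>1\<close> is
  \<open>2 arcosh (\<bar>trace\<bar> / 2)\<close>. A lift of a hyperbolic element \<open>A\<close> is \<open>a + d Z\<close> with \<open>a d > 0\<close>, where \<open>Z\<close>
  is the traceless matrix of \<open>X\<^sup>0\<^sub>A\<close> and \<open>Z\<^sup>2 = 1\<close>. Differentiating the trace along \<open>exp (t u(A) + O(t\<^sup>2))\<close>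
  gives the Margulis invariant of \<open>u\<close> at \<open>A\<close> for half the derivative of the length
  (\<open>length_fun_derivative\<close>). That invariant is linear in the cocycle, so the theorem reduces to the affine
  twists: the invariant of \<open>AT k\<close> at \<open>f\<close> has to be \<open>0\<close> for \<open>k \<noteq> l\<close> and \<open>cos \<theta> + cos \<theta>'\<close> for \<open>k = l\<close>.

  Their invariants are found along one period of the axis of \<open>f\<close>. Starting at \<open>x\<close>, on the axis of \<open>C h\<^sub>l C\<^sup>-\<^sup>1\<close>, it
  runs through a translate of \<open>R\<^sub>l\<^sub>+\<^sub>1\<close> up to a translate \<open>F y\<close> of \<open>y\<close> by a power \<open>F\<close> of \<open>f\<close>, and then
  through a translate of \<open>R\<^sub>l\<close> up to \<open>f x\<close>. The regions \<open>R\<^sub>l\<close> and \<open>R\<^sub>l\<^sub>+\<^sub>1\<close> are convex and invariant under \<open>h\<^sub>l\<close>,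
  so each contains all points close to the axis of \<open>h\<^sub>l\<close> on one of its sides; this makes the regions on the
  two sides of the crossing at \<open>x\<close> equal to \<open>C R\<^sub>l\<close> and \<open>C R\<^sub>l\<^sub>+\<^sub>1\<close> (\<open>crossing_germ\<close>), and likewise at \<open>y\<close>.
  Comparing the descriptions of each region from its two ends gives \<open>C = F C' q\<close> and \<open>f C = F C' p\<close>
  with \<open>q\<close> in \<open>P\<^sub>l\<^sub>+\<^sub>1\<close> and \<open>p\<close> in \<open>P\<^sub>l\<close> (\<open>two_crossings_factorization\<close>). On both pants groups an affine twist
  is an explicit coboundary, so the cocycle identity evaluates its Margulis invariant: it is \<open>0\<close> unless
  \<open>k = l\<close>, and then it is \<open>B (C Y\<^sub>l) X\<^sup>0\<^sub>f - B (C' Y\<^sub>l) X\<^sup>0\<^sub>f\<close> (\<open>margulis_affine_twist\<close>).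

  It remains to recognize the angles. At a point \<open>x\<close> of the axis of \<open>A\<close> the vector \<open>X\<^sup>0\<^sub>A\<close> is the Lorentzian
  cross product of \<open>x\<close> with the forward tangent vector. So for two axes through \<open>x\<close> the product of their
  vectors \<open>X\<^sup>0\<close> is the cosine of the angle between them (\<open>cos_axis_angle\<close>); at \<open>y\<close> the minus sign is absorbed
  by the definition of \<open>\<theta>'\<close>.\<close>

section \<open>The Lorentz form and its isometries\<close>

lemma B_commute: "B x y = B y x"
  by (simp add: B_def mult.commute)

lemma B_linear [simp]:
  "B (x + y) z = B x z + B y z" "B z (x + y) = B z x + B z y"
  "B (x - y) z = B x z - B y z" "B z (x - y) = B z x - B z y"
  "B (a *\<^sub>R x) z = a * B x z" "B z (a *\<^sub>R x) = a * B z x"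
  "B (- x) z = - B x z" "B z (- x) = - B z x" "B 0 z = 0" "B z 0 = 0"
  by (simp_all add: B_def algebra_simps)

lemma continuous_on_B [continuous_intros]:
  "continuous_on S p \<Longrightarrow> continuous_on S q \<Longrightarrow> continuous_on S (\<lambda>s. B (p s) (q s))"
  unfolding B_def by (intro continuous_intros)

lemma H2_iff: "x \<in> H2 \<longleftrightarrow> B x x = -1 \<and> x$3 > 0"
  by (simp add: H2_def)

text \<open>The reversed Cauchy-Schwarz inequality: a future vector has third coordinate at least the Euclidean
  length of its horizontal part, strictly so if it is timelike.\<close>

lemma B_future_neg:
  assumes "B x x \<le> 0" "x$3 > 0" "B y y < 0" "y$3 > 0"
  shows "B x y < 0"
proof -
  have x: "sqrt ((x$1)\<^sup>2 + (x$2)\<^sup>2) \<le> x$3"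
    using assms(1,2) by (intro real_le_lsqrt) (auto simp: B_def power2_eq_square)
  have y: "sqrt ((y$1)\<^sup>2 + (y$2)\<^sup>2) < y$3"
    using assms(3,4) by (intro real_less_lsqrt) (auto simp: B_def power2_eq_square)
  have "x$1 * y$1 + x$2 * y$2 \<le> sqrt ((x$1)\<^sup>2 + (x$2)\<^sup>2) * sqrt ((y$1)\<^sup>2 + (y$2)\<^sup>2)"
  proof -
    have "(x$1 * y$1 + x$2 * y$2)\<^sup>2 \<le> ((x$1)\<^sup>2 + (x$2)\<^sup>2) * ((y$1)\<^sup>2 + (y$2)\<^sup>2)"
      using zero_le_power2[of "x$1 * y$2 - x$2 * y$1"] by (simp add: power2_eq_square algebra_simps)
    then show ?thesis
      by (metis real_le_rsqrt real_sqrt_mult)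
  qed
  also have "\<dots> \<le> x$3 * sqrt ((y$1)\<^sup>2 + (y$2)\<^sup>2)"
    using x by (intro mult_right_mono) auto
  also have "\<dots> < x$3 * y$3"
    using y assms(2) by (intro mult_strict_left_mono)
  finally show ?thesis by (simp add: B_def)
qed

lemma causal_third_nonzero:
  assumes "B x x \<le> 0" "x \<noteq> 0"
  shows "x$3 \<noteq> 0"
proof
  assume "x$3 = 0"
  with assms(1) have "(x$1)\<^sup>2 + (x$2)\<^sup>2 \<le> 0"
    by (simp add: B_def power2_eq_square)
  then have "x$1 = 0 \<and> x$2 = 0"
    by (simp add: sum_power2_le_zero_iff)
  with \<open>x$3 = 0\<close> \<open>x \<noteq> 0\<close> show False
    by (simp add: vec_eq_iff forall_3)
qed

text \<open>A nonzero causal vector or its negative is future-pointing, so its product with a timelike vector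
  cannot vanish.\<close>

lemma spacelike_if_orthogonal_timelike:
  assumes "B y y < 0" "y$3 > 0" "B x y = 0" "x \<noteq> 0"
  shows "B x x > 0"
proof (rule ccontr)
  assume "\<not> B x x > 0"
  then have x: "B x x \<le> 0" by simp
  from causal_third_nonzero[OF this \<open>x \<noteq> 0\<close>] consider "x$3 > 0" | "(-x)$3 > 0" by fastforce
  then show False
  proof cases
    case 1
    then show False using B_future_neg[OF x 1 assms(1,2)] assms(3) by simp
  next
    case 2
    then show False using B_future_neg[of "-x" y] x assms by simp
  qed
qed

text \<open>Cauchy-Schwarz is strict for vectors that are not parallel: as \<open>m\<close> and \<open>p\<close> are null, the squared length of
  \<open>p\<^sub>3 m - m\<^sub>3 p\<close> is \<open>-2 m\<^sub>3 p\<^sub>3 B m p\<close>.\<close>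

lemma B_null_neg:
  assumes "B m m = 0" "m$3 > 0" "B p p = 0" "p$3 > 0" "p$3 *\<^sub>R m \<noteq> m$3 *\<^sub>R p"
  shows "B m p < 0"
proof -
  have "(p$3 * m$1 - m$3 * p$1)\<^sup>2 + (p$3 * m$2 - m$3 * p$2)\<^sup>2
      = (p$3)\<^sup>2 * (B m m) + (m$3)\<^sup>2 * (B p p) - 2 * (m$3 * p$3) * B m p"
    by (simp add: B_def power2_eq_square algebra_simps)
  moreover have "(p$3 * m$1 - m$3 * p$1)\<^sup>2 + (p$3 * m$2 - m$3 * p$2)\<^sup>2 > 0"
    using assms(5) by (simp add: sum_power2_gt_zero_iff vec_eq_iff forall_3)
  ultimately have "(m$3 * p$3) * B m p < 0"
    using assms(1,3) by (simp add: mult.commute)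
  then show ?thesis
    using assms(2,4) by (simp add: mult_less_0_iff zero_less_mult_iff)
qed

text \<open>Through \<open>flip\<close> the form \<open>B\<close> becomes the Euclidean inner product, for which half-spaces,
  cross products and kernels of matrices are available.\<close>

definition flip :: "real^3 \<Rightarrow> real^3" where
  "flip x = vector [x$1, x$2, - x$3]"

lemma B_eq_inner: "B x y = x \<bullet> flip y"
  by (simp add: B_def flip_def inner_vec_def sum_3)

text \<open>The cross product adapted to \<open>B\<close>.\<close>

definition wedge :: "real^3 \<Rightarrow> real^3 \<Rightarrow> real^3" where
  "wedge x y = flip (cross3 x y)"

lemma B_wedge: "B (wedge x y) z = det (vector [x, y, z] :: real^3^3)"
  by (simp add: wedge_def flip_def cross3_simps B_def)

lemma B_wedge_wedge: "B (wedge x y) (wedge x z) = B x y * B x z - B x x * B y z"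
  by (simp add: wedge_def flip_def cross3_simps B_def)

lemma B_wedge_orthogonal [simp]: "B (wedge x y) x = 0" "B (wedge x y) y = 0"
  by (simp_all add: B_wedge cross3_simps)

text \<open>Membership in a connected component is awkward to compute with. The three conditions here hold on
  \<open>SO0\<close> and visibly pass to products and inverses.\<close>

definition isometries :: "(real^3^3) set" where
  "isometries = {A. (\<forall>x y. B (A *v x) (A *v y) = B x y) \<and> det A = 1 \<and> (\<forall>x\<in>H2. A *v x \<in> H2)}"

lemma B_isometry [simp]: "A \<in> isometries \<Longrightarrow> B (A *v x) (A *v y) = B x y"
  by (simp add: isometries_def)

lemma isometry_H2: "A \<in> isometries \<Longrightarrow> x \<in> H2 \<Longrightarrow> A *v x \<in> H2"
  unfolding isometries_def by blast

text \<open>Otherwise the images of \<open>x\<close> and of the point \<open>(0, 0, 1)\<close> of \<open>H2\<close> would lie in opposite cones and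
  have a positive product.\<close>

lemma isometry_future:
  assumes "A \<in> isometries" "B x x \<le> 0" "x$3 > 0"
  shows "(A *v x)$3 > 0"
proof (rule ccontr)
  assume *: "\<not> (A *v x)$3 > 0"
  let ?e = "axis 3 1 :: real^3"
  have e: "?e \<in> H2" by (simp add: H2_iff B_def axis_def)
  have "B x ?e < 0" using assms by (simp add: B_def axis_def)
  then have neg: "B (A *v x) (A *v ?e) < 0" using assms(1) by simp
  then have nz: "A *v x \<noteq> 0" by auto
  have "(A *v x)$3 \<noteq> 0"
    by (intro causal_third_nonzero nz) (use assms in simp)
  with * have "(- (A *v x))$3 > 0" by simp
  then have "B (- (A *v x)) (A *v ?e) < 0"
    using isometry_H2[OF assms(1) e] assms by - (rule B_future_neg, auto simp: H2_iff)
  with neg show False by simp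
qed

text \<open>The Gram matrix \<open>J\<close> of \<open>B\<close> satisfies \<open>A\<^sup>T J A = J\<close>.\<close>

lemma B_preserving_det_sq:
  assumes "\<forall>x y. B (A *v x) (A *v y) = B x y"
  shows "(det A)\<^sup>2 = 1"
proof -
  define J :: "real^3^3" where "J = vector [axis 1 1, axis 2 1, - axis 3 1]"
  have J: "B x y = x \<bullet> (J *v y)" for x y
    by (simp add: B_def J_def inner_vec_def sum_3 matrix_vector_mult_def axis_def)
  have "x \<bullet> ((transpose A ** J ** A) *v y) = x \<bullet> (J *v y)" for x y
  proof -
    have "x \<bullet> ((transpose A ** J ** A) *v y) = (x v* transpose A) \<bullet> (J *v (A *v y))"
      by (simp only: matrix_vector_mul_assoc[symmetric] dot_lmul_matrix)
    also have "\<dots> = B (A *v x) (A *v y)"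
      by (simp only: J vector_transpose_matrix)
    finally show ?thesis using assms by (simp add: J)
  qed
  then have "(transpose A ** J ** A) *v y = J *v y" for y
    using vector_eq_ldot by blast
  then have "transpose A ** J ** A = J"
    by (simp add: matrix_eq)
  then have "det A * det J * det A = det J"
    by (metis det_mul det_transpose)
  moreover have "det J = -1"
    by (simp add: J_def det_3 axis_def)
  ultimately show ?thesis by (simp add: power2_eq_square)
qed

text \<open>The determinant and the third coordinate of \<open>A (0, 0, 1)\<close> vanish for no matrix that preserves \<open>B\<close>.
  Both are positive at the identity, hence on its connected component. If the point \<open>(0, 0, 1)\<close> stays in
  the future cone, so does every other point of \<open>H2\<close>, because vectors of opposite cones have a positive
  product.\<close>

lemma SO0_subset_isometries: "SO0 \<subseteq> isometries"
proof -
  define S where "S = {A::real^3^3. \<forall>x y. B (A *v x) (A *v y) = B x y}"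
  have con: "connected SO0"
    by (simp add: SO0_def)
  have sub: "SO0 \<subseteq> S"
    unfolding SO0_def S_def by (rule connected_component_subset)
  have "mat 1 \<in> S" by (simp add: S_def)
  then have one: "mat 1 \<in> SO0"
    unfolding SO0_def S_def by (simp add: connected_component_refl)
  have pos: "q A > 0" if "continuous_on SO0 q" "\<And>A. A \<in> SO0 \<Longrightarrow> q A \<noteq> 0" "q (mat 1) > 0" "A \<in> SO0"
    for q :: "real^3^3 \<Rightarrow> real" and A
  proof (rule ccontr)
    assume "\<not> q A > 0"
    moreover have "connected (q ` SO0)"
      using con that(1) by (rule connected_continuous_image[rotated])
    ultimately have "0 \<in> q ` SO0"
      using connectedD_interval[of "q ` SO0" "q A" "q (mat 1)" 0] that(3,4) one by auto
    then show False using that(2) by auto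
  qed
  show ?thesis
  proof
    fix A assume A: "A \<in> SO0"
    have "det A > 0"
    proof (rule pos[where q = det])
      show "continuous_on SO0 (det :: real^3^3 \<Rightarrow> real)"
        unfolding det_3 by (intro continuous_intros)
      show "det A \<noteq> 0" if "A \<in> SO0" for A :: "real^3^3"
        using B_preserving_det_sq[of A] that sub by (auto simp: S_def)
    qed (use A in auto)
    moreover have "(det A)\<^sup>2 = 1"
      using B_preserving_det_sq[of A] A sub by (auto simp: S_def)
    ultimately have det: "det A = 1"
      by (simp add: power2_eq_1_iff)
    let ?e = "axis 3 1 :: real^3"
    have Ae: "B (A *v ?e) (A *v ?e) = -1" if "A \<in> SO0" for A
      using that sub by (auto simp: S_def B_def axis_def)
    have e3: "(A *v ?e)$3 > 0"
    proof (rule pos[where q = "\<lambda>A. (A *v ?e)$3"])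
      show "continuous_on SO0 (\<lambda>A. (A *v ?e)$3)"
        unfolding matrix_vector_mult_def by (simp add: sum_3) (intro continuous_intros)
      show "(A *v ?e)$3 \<noteq> 0" if "A \<in> SO0" for A
        using causal_third_nonzero[of "A *v ?e"] Ae[OF that] by force
    qed (use A in \<open>auto simp: axis_def\<close>)
    have "A *v x \<in> H2" if x: "x \<in> H2" for x
    proof -
      have Ax: "B (A *v x) (A *v x) = -1"
        using x A sub by (auto simp: S_def H2_iff)
      have "B (A *v x) (A *v ?e) = B x ?e"
        using A sub by (auto simp: S_def)
      also have "\<dots> < 0" using x by (simp add: B_def axis_def H2_iff)
      finally have neg: "B (A *v x) (A *v ?e) < 0" .
      have "(A *v x)$3 > 0"
      proof (rule ccontr)
        assume "\<not> (A *v x)$3 > 0"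
        moreover have "(A *v x)$3 \<noteq> 0"
          using causal_third_nonzero[of "A *v x"] Ax by force
        ultimately have "(- (A *v x))$3 > 0" by simp
        then have "B (- (A *v x)) (A *v ?e) < 0"
          using Ax Ae[OF A] e3 by - (rule B_future_neg, auto)
        with neg show False by simp
      qed
      with Ax show ?thesis by (simp add: H2_iff)
    qed
    moreover have "A \<in> S" using A sub by blast
    ultimately show "A \<in> isometries"
      using det unfolding isometries_def S_def by blast
  qed
qed

lemma isometry_det: "A \<in> isometries \<Longrightarrow> det A = 1"
  unfolding isometries_def by blast

lemma isometriesI:
  "(\<And>x y. B (A *v x) (A *v y) = B x y) \<Longrightarrow> det A = 1 \<Longrightarrow> (\<And>x. x \<in> H2 \<Longrightarrow> A *v x \<in> H2) \<Longrightarrow> A \<in> isometries"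
  unfolding isometries_def by blast

lemma isometry_invertible: "A \<in> isometries \<Longrightarrow> invertible A"
  by (simp add: isometry_det invertible_det_nz)

lemma isometry_inv [simp]:
  assumes "A \<in> isometries"
  shows "A ** matrix_inv A = mat 1" "matrix_inv A ** A = mat 1"
    "A *v (matrix_inv A *v x) = x" "matrix_inv A *v (A *v x) = x"
proof -
  have "A ** matrix_inv A = mat 1 \<and> matrix_inv A ** A = mat 1"
    using isometry_invertible[OF assms] unfolding matrix_inv_def invertible_def
    by (rule someI_ex)
  then show "A ** matrix_inv A = mat 1" "matrix_inv A ** A = mat 1"
    "A *v (matrix_inv A *v x) = x" "matrix_inv A *v (A *v x) = x"
    by (simp_all add: matrix_vector_mul_assoc)
qed

lemma isometries_one: "mat 1 \<in> isometries"
  by (rule isometriesI) simp_all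

lemma isometries_mult: "A \<in> isometries \<Longrightarrow> A' \<in> isometries \<Longrightarrow> A ** A' \<in> isometries"
  by (rule isometriesI)
    (simp_all add: matrix_vector_mul_assoc[symmetric] det_mul isometry_det isometry_H2)

lemma isometries_inv:
  assumes A: "A \<in> isometries"
  shows "matrix_inv A \<in> isometries"
proof -
  have B: "B (matrix_inv A *v x) (matrix_inv A *v y) = B x y" for x y
    using B_isometry[OF A, of "matrix_inv A *v x" "matrix_inv A *v y"] A by simp
  have "det A * det (matrix_inv A) = 1"
    by (metis A det_I det_mul isometry_inv(1))
  then have "det (matrix_inv A) = 1"
    using A by (simp add: isometry_det)
  moreover have "matrix_inv A *v x \<in> H2" if x: "x \<in> H2" for x
  proof (rule ccontr)
    assume no: "matrix_inv A *v x \<notin> H2"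
    let ?y = "matrix_inv A *v x"
    have y: "B ?y ?y = -1" using B x by (simp add: H2_iff)
    then have "?y$3 \<noteq> 0" using causal_third_nonzero[of ?y] by force
    with no y have "- ?y \<in> H2" by (simp add: H2_iff)
    from isometry_H2[OF A this] have "(A *v (- ?y))$3 > 0" by (simp add: H2_iff)
    then show False using x A by (simp add: H2_iff linear_neg[OF matrix_vector_mul_linear])
  qed
  ultimately show ?thesis
    using B by (intro isometriesI)
qed

lemma generated_closed:
  shows generated_one: "mat 1 \<in> generated S"
    and generated_mult: "A \<in> generated S \<Longrightarrow> A' \<in> generated S \<Longrightarrow> A ** A' \<in> generated S"
    and generated_inv: "A \<in> generated S \<Longrightarrow> matrix_inv A \<in> generated S"
proof -
  have *: "(\<lambda>H. mat 1 \<in> H \<and> (\<forall>A\<in>H. \<forall>A'\<in>H. A ** A' \<in> H) \<and> (\<forall>A\<in>H. matrix_inv A \<in> H)) (generated S)"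
    unfolding generated_def by (rule hull_in) auto
  show "mat 1 \<in> generated S"
    and "A \<in> generated S \<Longrightarrow> A' \<in> generated S \<Longrightarrow> A ** A' \<in> generated S"
    and "A \<in> generated S \<Longrightarrow> matrix_inv A \<in> generated S"
    using * by auto
qed

lemma generated_minimal:
  assumes "S \<subseteq> H" "mat 1 \<in> H" "\<And>A A'. A \<in> H \<Longrightarrow> A' \<in> H \<Longrightarrow> A ** A' \<in> H"
    "\<And>A. A \<in> H \<Longrightarrow> matrix_inv A \<in> H"
  shows "generated S \<subseteq> H"
  unfolding generated_def using assms by (intro hull_minimal) auto

lemma generated_superset: "A \<in> S \<Longrightarrow> A \<in> generated S"
  unfolding generated_def by (rule hull_inc)

lemma generated_isometries: "S \<subseteq> isometries \<Longrightarrow> generated S \<subseteq> isometries"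
  by (intro generated_minimal) (auto intro: isometries_one isometries_mult isometries_inv)

section \<open>Eigenframes of hyperbolic isometries\<close>

text \<open>The eigenvectors \<open>X\<^sup>-\<close>, \<open>X\<^sup>+\<close>, \<open>X\<^sup>0\<close> of a hyperbolic element, with the two null ones only determined
  up to positive factors. Euclidean length is not preserved by isometries, so without normalization a
  frame of \<open>A\<close> is carried by \<open>D\<close> to a frame of \<open>D A D\<^sup>-\<^sup>1\<close>.\<close>

definition eigenframe :: "real^3^3 \<Rightarrow> real \<Rightarrow> real^3 \<Rightarrow> real^3 \<Rightarrow> real^3 \<Rightarrow> bool" where
  "eigenframe A c m p z \<longleftrightarrow> 0 < c \<and> c < 1 \<and>
     A *v m = c *\<^sub>R m \<and> A *v p = inverse c *\<^sub>R p \<and> A *v z = z \<and>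
     B m m = 0 \<and> B p p = 0 \<and> B z z = 1 \<and> B m z = 0 \<and> B p z = 0 \<and>
     m$3 > 0 \<and> p$3 > 0 \<and> B m p < 0 \<and> det (vector [z, m, p] :: real^3^3) > 0"

lemma eigenframeD:
  assumes "eigenframe A c m p z"
  shows "0 < c" "c < 1" "A *v m = c *\<^sub>R m" "A *v p = inverse c *\<^sub>R p" "A *v z = z"
    "B m m = 0" "B p p = 0" "B z z = 1" "B m z = 0" "B p z = 0" "B z m = 0" "B z p = 0"
    "m$3 > 0" "p$3 > 0" "B m p < 0" "B p m < 0" "det (vector [z, m, p] :: real^3^3) > 0"
  using assms B_commute[of p m] B_commute[of z m] B_commute[of z p] unfolding eigenframe_def by auto

text \<open>The vectors \<open>m\<close> and \<open>p\<close> are null, so each is dual to the other. The difference of both sides is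
  orthogonal to the three vectors, which are a basis by the determinant condition.\<close>

lemma eigenframe_expand:
  assumes "eigenframe A c m p z"
  shows "v = (B v p / B m p) *\<^sub>R m + (B v m / B m p) *\<^sub>R p + B v z *\<^sub>R z"
proof -
  note e = eigenframeD[OF assms]
  define d where "d = v - ((B v p / B m p) *\<^sub>R m + (B v m / B m p) *\<^sub>R p + B v z *\<^sub>R z)"
  have "B d m = 0" "B d p = 0" "B d z = 0"
    using e B_commute[of p m] by (auto simp: d_def)
  then have "z \<bullet> flip d = 0" "m \<bullet> flip d = 0" "p \<bullet> flip d = 0"
    using B_commute by (auto simp: B_eq_inner[symmetric])
  then have "(vector [z, m, p] :: real^3^3) *v flip d = 0"
    by (simp add: vec_eq_iff forall_3 matrix_vector_mul_component row_def)
  then have "flip d = 0"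
    using e(17) by (metis invertible_det_nz less_irrefl matrix_left_invertible_ker invertible_def)
  then have "d = 0"
    by (simp add: flip_def vec_eq_iff forall_3)
  then show ?thesis by (simp add: d_def)
qed

lemma eigenframe_eqI:
  assumes "eigenframe A c m p z" "B v m = B w m" "B v p = B w p" "B v z = B w z"
  shows "v = w"
  using eigenframe_expand[OF assms(1), of v] eigenframe_expand[OF assms(1), of w] assms(2-4) by simp

lemma eigenframe_B_image:
  assumes "eigenframe A c m p z"
  shows "B (A *v v) p = c * B v p" "B (A *v v) m = inverse c * B v m" "B (A *v v) z = B v z"
proof -
  note e = eigenframeD[OF assms]
  have "A *v v = A *v ((B v p / B m p) *\<^sub>R m + (B v m / B m p) *\<^sub>R p + B v z *\<^sub>R z)"
    using eigenframe_expand[OF assms, of v] by simp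
  also have "\<dots> = (c * B v p / B m p) *\<^sub>R m + (inverse c * B v m / B m p) *\<^sub>R p + B v z *\<^sub>R z"
    using e by (simp add: matrix_vector_right_distrib matrix_vector_mult_scaleR mult.commute)
  finally have *: "A *v v = (c * B v p / B m p) *\<^sub>R m + (inverse c * B v m / B m p) *\<^sub>R p + B v z *\<^sub>R z" .
  show "B (A *v v) p = c * B v p" "B (A *v v) m = inverse c * B v m" "B (A *v v) z = B v z"
    unfolding * using e by (simp_all add: B_commute[of p m])
qed

lemma eigenframe_eigenvector:
  assumes "eigenframe A c m p z" "A *v v = \<mu> *\<^sub>R v"
  shows "\<mu> \<noteq> c \<Longrightarrow> B v p = 0" "\<mu> \<noteq> inverse c \<Longrightarrow> B v m = 0" "\<mu> \<noteq> 1 \<Longrightarrow> B v z = 0"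
  using eigenframe_B_image[OF assms(1), of v] assms(2) by auto

lemma eigenframe_lam:
  assumes "eigenframe A c m p z"
  shows "lam A = c"
  unfolding lam_def
proof (rule the_equality)
  note e = eigenframeD[OF assms]
  show "0 < c \<and> c < 1 \<and> is_eigenvalue A c"
    using e unfolding is_eigenvalue_def by (metis less_irrefl zero_index)
  fix \<mu> assume \<mu>: "0 < \<mu> \<and> \<mu> < 1 \<and> is_eigenvalue A \<mu>"
  then obtain v where v: "v \<noteq> 0" "A *v v = \<mu> *\<^sub>R v"
    by (auto simp: is_eigenvalue_def)
  have "inverse c > 1" using e by (simp add: one_less_inverse)
  then have "B v m = 0" "B v z = 0"
    using eigenframe_eigenvector[OF assms v(2)] \<mu> by auto
  then have "B v p \<noteq> 0"
    using eigenframe_eqI[OF assms, of v 0] v(1) by auto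
  then show "\<mu> = c"
    using eigenframe_eigenvector[OF assms v(2)] by blast
qed

lemma unit_future_eq:
  assumes "x = a *\<^sub>R y" "x$3 > 0" "(y::real^3)$3 > 0" "norm x = 1"
  shows "x = (1 / norm y) *\<^sub>R y"
proof -
  have "a > 0" using assms(1-3) by (simp add: zero_less_mult_iff)
  moreover have "y \<noteq> 0" using assms(3) by auto
  ultimately show ?thesis using assms(1,4) by (simp add: field_simps)
qed

lemma eigenframe_Xminus:
  assumes "eigenframe A c m p z"
  shows "Xminus A = (1 / norm m) *\<^sub>R m"
  unfolding Xminus_def eigenframe_lam[OF assms]
proof (rule the_equality)
  note e = eigenframeD[OF assms]
  have "m \<noteq> 0" using e(13) by auto
  then show "A *v (1 / norm m) *\<^sub>R m = c *\<^sub>R (1 / norm m) *\<^sub>R m \<and> B ((1 / norm m) *\<^sub>R m) ((1 / norm m) *\<^sub>R m) = 0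
    \<and> 0 < ((1 / norm m) *\<^sub>R m) $ 3 \<and> norm ((1 / norm m) *\<^sub>R m) = 1"
    using e by (simp add: matrix_vector_mult_scaleR)
  fix x assume x: "A *v x = c *\<^sub>R x \<and> B x x = 0 \<and> 0 < x $ 3 \<and> norm x = 1"
  have "inverse c > 1" using e by (simp add: one_less_inverse)
  then have "B x m = 0" "B x z = 0"
    using eigenframe_eigenvector[OF assms, of x c] x e(1,2) by auto
  then have "x = (B x p / B m p) *\<^sub>R m"
    using eigenframe_expand[OF assms, of x] by simp
  then show "x = (1 / norm m) *\<^sub>R m"
    using x e(13) by (intro unit_future_eq) auto
qed

lemma eigenframe_Xplus:
  assumes "eigenframe A c m p z"
  shows "Xplus A = (1 / norm p) *\<^sub>R p"
  unfolding Xplus_def eigenframe_lam[OF assms]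
proof (rule the_equality)
  note e = eigenframeD[OF assms]
  have "p \<noteq> 0" using e(14) by auto
  then show "A *v (1 / norm p) *\<^sub>R p = inverse c *\<^sub>R (1 / norm p) *\<^sub>R p \<and> B ((1 / norm p) *\<^sub>R p) ((1 / norm p) *\<^sub>R p) = 0
    \<and> 0 < ((1 / norm p) *\<^sub>R p) $ 3 \<and> norm ((1 / norm p) *\<^sub>R p) = 1"
    using e by (simp add: matrix_vector_mult_scaleR)
  fix x assume x: "A *v x = inverse c *\<^sub>R x \<and> B x x = 0 \<and> 0 < x $ 3 \<and> norm x = 1"
  have "inverse c > 1" using e by (simp add: one_less_inverse)
  then have "B x p = 0" "B x z = 0"
    using eigenframe_eigenvector[OF assms, of x "inverse c"] x e(1,2) by auto
  then have "x = (B x m / B m p) *\<^sub>R p"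
    using eigenframe_expand[OF assms, of x] by simp
  then show "x = (1 / norm p) *\<^sub>R p"
    using x e(14) by (intro unit_future_eq) auto
qed

text \<open>A fixed vector is a multiple of \<open>z\<close>; unit length leaves a sign, which the orientation decides.\<close>

lemma eigenframe_Xzero:
  assumes "eigenframe A c m p z"
  shows "Xzero A = z"
  unfolding Xzero_def eigenframe_Xminus[OF assms] eigenframe_Xplus[OF assms]
proof (rule the_equality)
  note e = eigenframeD[OF assms]
  have nz: "m \<noteq> 0" "p \<noteq> 0" using e(13,14) by auto
  have det: "det (vector [x, (1 / norm m) *\<^sub>R m, (1 / norm p) *\<^sub>R p] :: real^3^3)
      = det (vector [x, m, p] :: real^3^3) / (norm m * norm p)" for x
    using nz by (simp add: det_3 field_simps)
  show "A *v z = z \<and> B z z = 1 \<and> 0 < det (vector [z, (1 / norm m) *\<^sub>R m, (1 / norm p) *\<^sub>R p] :: real^3^3)"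
    using e nz by (simp add: det)
  fix x assume x: "A *v x = x \<and> B x x = 1 \<and> 0 < det (vector [x, (1 / norm m) *\<^sub>R m, (1 / norm p) *\<^sub>R p] :: real^3^3)"
  have "inverse c > 1" using e by (simp add: one_less_inverse)
  then have "B x m = 0" "B x p = 0"
    using eigenframe_eigenvector[OF assms, of x 1] x e(1,2) by auto
  then obtain k where xz: "x = k *\<^sub>R z"
    using eigenframe_expand[OF assms, of x] by auto
  then have "k = 1 \<or> k = -1"
    using x e(8) by (simp add: power2_eq_1_iff flip: power2_eq_square)
  moreover have "k \<noteq> -1"
  proof
    assume "k = -1"
    then have "det (vector [x, m, p] :: real^3^3) = - det (vector [z, m, p] :: real^3^3)"
      by (simp add: xz det_3)
    moreover have "det (vector [x, m, p] :: real^3^3) > 0"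
      using x nz mult_nonneg_nonneg[OF norm_ge_zero norm_ge_zero, of m p]
      by (simp add: det zero_less_divide_iff)
    ultimately show False using e(17) by simp
  qed
  ultimately show "x = z" using xz by simp
qed

lemma isometry_image_det:
  assumes "D \<in> isometries"
  shows "det (vector [D *v x, D *v y, D *v w] :: real^3^3) = det (vector [x, y, w] :: real^3^3)"
proof -
  have "(vector [D *v x, D *v y, D *v w] :: real^3^3) = vector [x, y, w] ** transpose D"
    by (simp add: vec_eq_iff forall_3 matrix_matrix_mult_def matrix_vector_mult_def sum_3 transpose_def mult.commute)
  then show ?thesis
    using assms by (simp add: det_mul isometry_det)
qed

lemma eigenframe_conj:
  assumes "eigenframe A c m p z" "D \<in> isometries"
  shows "eigenframe (D ** A ** matrix_inv D) c (D *v m) (D *v p) (D *v z)"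
  using eigenframeD[OF assms(1)] assms(2) isometry_future[OF assms(2)]
  unfolding eigenframe_def
  by (simp add: matrix_vector_mul_assoc[symmetric] matrix_vector_mult_scaleR isometry_image_det B_isometry)

text \<open>Invariance of \<open>B\<close> makes eigenvectors for eigenvalues other than \<open>1\<close> null, and makes a fixed vector
  orthogonal to them. Orthogonality to the timelike vector \<open>m + p\<close> then shows that the fixed vector is
  spacelike.\<close>

lemma hyperbolic_eigenframe:
  assumes "hyperbolic A"
  obtains c m p z where "eigenframe A c m p z"
proof -
  from assms obtain c v1 v2 v0 where A: "A \<in> SO0" and c: "0 < c" "c < 1"
    and v: "v1 \<noteq> 0" "A *v v1 = c *\<^sub>R v1" "v2 \<noteq> 0" "A *v v2 = inverse c *\<^sub>R v2" "v0 \<noteq> 0" "A *v v0 = v0"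
    unfolding hyperbolic_def is_eigenvalue_def by auto
  have iso: "A \<in> isometries" using A SO0_subset_isometries by blast
  have c': "inverse c > 1" using c by (simp add: one_less_inverse)
  have null: "B v v = 0" if "A *v v = \<mu> *\<^sub>R v" "\<mu> > 0" "\<mu> \<noteq> 1" for v \<mu>
  proof -
    have "B v v = \<mu>\<^sup>2 * B v v"
      using B_isometry[OF iso, of v v] that(1) by (simp add: power2_eq_square)
    moreover have "\<mu>\<^sup>2 \<noteq> 1" using that by (simp add: power2_eq_1_iff)
    ultimately show ?thesis by simp
  qed
  have future: "\<exists>w. w$3 > 0 \<and> A *v w = \<mu> *\<^sub>R w \<and> B w w = 0" if "A *v v = \<mu> *\<^sub>R v" "\<mu> > 0" "\<mu> \<noteq> 1" "v \<noteq> 0" for v \<mu>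
  proof -
    have "v$3 \<noteq> 0" using causal_third_nonzero[of v] null[OF that(1-3)] that(4) by simp
    then consider "v$3 > 0" | "(-v)$3 > 0" by fastforce
    then show ?thesis
    proof cases
      case 1
      then show ?thesis using that null[OF that(1-3)] by blast
    next
      case 2
      then show ?thesis
        using that(1) null[OF that(1-3)]
        by (intro exI[of _ "-v"]) (simp add: linear_neg[OF matrix_vector_mul_linear])
    qed
  qed
  from future[OF v(2)] c v(1) obtain m where m: "m$3 > 0" "A *v m = c *\<^sub>R m" "B m m = 0" by auto
  from future[OF v(4)] c c' v(3) obtain p where p: "p$3 > 0" "A *v p = inverse c *\<^sub>R p" "B p p = 0" by auto
  have "B m p < 0"
  proof (rule B_null_neg)
    show "p$3 *\<^sub>R m \<noteq> m$3 *\<^sub>R p"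
    proof
      assume *: "p$3 *\<^sub>R m = m$3 *\<^sub>R p"
      then have "p$3 *\<^sub>R (A *v m) = m$3 *\<^sub>R (A *v p)"
        by (metis matrix_vector_mult_scaleR)
      then have "c *\<^sub>R (p$3 *\<^sub>R m) = inverse c *\<^sub>R (m$3 *\<^sub>R p)"
        by (simp add: m p mult.commute)
      then have "c * (m$3 * p$3) = inverse c * (m$3 * p$3)"
        unfolding * by (metis real_scaleR_def vector_scaleR_component)
      then show False using m(1) p(1) c c' by auto
    qed
  qed (use m p in auto)
  have orth: "B v w = 0" if "A *v v = \<mu> *\<^sub>R v" "A *v w = w" "\<mu> \<noteq> 1" for v w \<mu>
    using B_isometry[OF iso, of v w] that by simp
  have o: "B m v0 = 0" "B p v0 = 0"
    using orth[OF m(2) v(6)] orth[OF p(2) v(6)] c c' by auto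
  have "B v0 v0 > 0"
  proof (rule spacelike_if_orthogonal_timelike)
    show "B (m + p) (m + p) < 0" using m p \<open>B m p < 0\<close> B_commute[of p m] by simp
    show "(m + p) $ 3 > 0" using m p by simp
    show "B v0 (m + p) = 0" using o B_commute by simp
  qed (use v in auto)
  define n where "n = (1 / sqrt (B v0 v0)) *\<^sub>R v0"
  have n: "A *v n = n" "B n n = 1" "B m n = 0" "B p n = 0"
    using \<open>B v0 v0 > 0\<close> v o by (simp_all add: n_def matrix_vector_mult_scaleR)
  have "det (vector [n, m, p] :: real^3^3) \<noteq> 0"
  proof
    assume "det (vector [n, m, p] :: real^3^3) = 0"
    then have "B (wedge n m) p = 0" by (simp add: B_wedge)
    moreover have "B (wedge n m) (wedge n m) = 0" 
      using n m B_commute[of n m] by (simp add: B_wedge_wedge)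
    moreover have "B (wedge n m) m = 0" by simp
    ultimately have w: "B (wedge n m) (m + p) = 0" "\<not> B (wedge n m) (wedge n m) > 0" by auto
    have "wedge n m = 0"
    proof (rule ccontr)
      assume "wedge n m \<noteq> 0"
      from spacelike_if_orthogonal_timelike[OF _ _ w(1) this] w(2) show False
        using m p \<open>B m p < 0\<close> B_commute[of p m] by simp
    qed
    then have "B (wedge n m) (wedge n p) = 0" by simp
    then show False
      using n m \<open>B m p < 0\<close> B_commute[of n m] B_commute[of n p] by (simp add: B_wedge_wedge)
  qed
  then consider "det (vector [n, m, p] :: real^3^3) > 0" | "det (vector [- n, m, p] :: real^3^3) > 0"
    by (fastforce simp: det_3)
  then show thesis
  proof cases
    case 1
    then show thesis using n m p c \<open>B m p < 0\<close> by (intro that[of c m p n]) (simp add: eigenframe_def)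
  next
    case 2
    then show thesis using n m p c \<open>B m p < 0\<close>
      by (intro that[of c m p "-n"]) (simp add: eigenframe_def linear_neg[OF matrix_vector_mul_linear])
  qed
qed

lemma eigenframe_axis:
  assumes "eigenframe A c m p z"
  shows "axis_of A = {x \<in> H2. B x z = 0}"
proof -
  note e = eigenframeD[OF assms]
  have nz: "norm m > 0" "norm p > 0" using e(13,14) by auto
  have "x \<in> span {Xminus A, Xplus A} \<longleftrightarrow> B x z = 0" for x
  proof
    assume "x \<in> span {Xminus A, Xplus A}"
    then show "B x z = 0"
      unfolding eigenframe_Xminus[OF assms] eigenframe_Xplus[OF assms]
      by (induction rule: span_induct) (auto simp: subspace_def e)
  next
    assume "B x z = 0"
    then have "x = (B x p / B m p * norm m) *\<^sub>R Xminus A + (B x m / B m p * norm p) *\<^sub>R Xplus A"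
      using eigenframe_expand[OF assms, of x] nz
      by (simp add: eigenframe_Xminus[OF assms] eigenframe_Xplus[OF assms])
    then show "x \<in> span {Xminus A, Xplus A}"
      by (metis insertI1 insertI2 singletonI span_add span_base span_scale)
  qed
  then show ?thesis by (auto simp: axis_of_def)
qed

lemma eigenframe_coordinates_pos:
  assumes "eigenframe A c m p z" "x \<in> H2"
  shows "B x m < 0" "B x p < 0" "B m x < 0" "B p x < 0" "B x p / B m p > 0" "B x m / B m p > 0"
proof -
  note e = eigenframeD[OF assms(1)]
  show "B m x < 0" "B p x < 0"
    using B_future_neg[of m x] B_future_neg[of p x] assms(2) e by (auto simp: H2_iff)
  then show "B x m < 0" "B x p < 0"
    by (simp_all add: B_commute[of x])
  then show "B x p / B m p > 0" "B x m / B m p > 0"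
    using e by (simp_all add: zero_less_divide_iff)
qed

section \<open>Axes and the angles between them\<close>

text \<open>The parameter is the eigenvalue of the contracted null vector.\<close>

definition translation_length :: "real \<Rightarrow> real" where
  "translation_length c = - ln c"

lemma translation_length_pos: "0 < c \<Longrightarrow> c < 1 \<Longrightarrow> translation_length c > 0"
  by (simp add: translation_length_def)

text \<open>In the coordinates \<open>a\<close>, \<open>b\<close> the isometry multiplies \<open>a\<close> by \<open>c\<close> and divides \<open>b\<close> by \<open>c\<close>, so
  moving forward means decreasing \<open>a\<close> and increasing \<open>b\<close>.\<close>

lemma axis_coordinates:
  assumes fr: "eigenframe A c m p z" and x: "x \<in> axis_of A"
  obtains a b where "a > 0" "b > 0" "x = a *\<^sub>R m + b *\<^sub>R p" "2 * a * b * B m p = -1"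
    "forward_tangent A x = b *\<^sub>R p - a *\<^sub>R m"
proof -
  note e = eigenframeD[OF fr]
  define a b where "a = B x p / B m p" and "b = B x m / B m p"
  have H: "x \<in> H2" "B x z = 0" using x eigenframe_axis[OF fr] by auto
  have pos: "a > 0" "b > 0"
    using eigenframe_coordinates_pos[OF fr H(1)] by (simp_all add: a_def b_def)
  have xab: "x = a *\<^sub>R m + b *\<^sub>R p"
    using eigenframe_expand[OF fr, of x] H by (simp add: a_def b_def)
  have norm: "2 * a * b * B m p = -1"
    using H(1) e by (simp add: xab H2_iff B_commute[of p m])
  have Ax: "A *v x = (a * c) *\<^sub>R m + (b / c) *\<^sub>R p"
    using e by (simp add: xab matrix_vector_right_distrib matrix_vector_mult_scaleR divide_inverse)
  define k where "k = c + 1 / c"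
  have "B x (A *v x) = (a * b * B m p) * k"
    using e unfolding Ax by (simp add: xab k_def B_commute[of p m] field_simps)
  moreover have "a * b * B m p = - (1 / 2)" using norm by simp
  ultimately have Bx: "B x (A *v x) = - (k / 2)" by simp
  have c1: "1 / c > c" using e by (smt (verit) less_divide_eq_1_pos)
  have "(B x (A *v x))\<^sup>2 - 1 = ((1 / c - c) / 2)\<^sup>2"
    unfolding Bx k_def using e by (simp add: power2_eq_square field_simps)
  then have sq: "sqrt ((B x (A *v x))\<^sup>2 - 1) = (1 / c - c) / 2"
    using c1 by (simp add: real_sqrt_unique)
  have "forward_tangent A x = (2 / (1 / c - c)) *\<^sub>R (A *v x - (k / 2) *\<^sub>R x)"
    unfolding forward_tangent_def toward_def sq unfolding Bx by simp
  also have "A *v x - (k / 2) *\<^sub>R x = ((1 / c - c) / 2) *\<^sub>R (b *\<^sub>R p - a *\<^sub>R m)"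
    unfolding Ax k_def by (simp add: xab vec_eq_iff forall_3) (simp add: field_simps)
  finally have ft: "forward_tangent A x = (2 / (1 / c - c) * ((1 / c - c) / 2)) *\<^sub>R (b *\<^sub>R p - a *\<^sub>R m)"
    by (simp only: scaleR_scaleR)
  have "2 / w * (w / 2) = 1" if "w > 0" for w :: real using that by simp
  from this[of "1 / c - c"] c1 have "forward_tangent A x = b *\<^sub>R p - a *\<^sub>R m"
    unfolding ft by (simp only: scaleR_one diff_gt_0_iff_gt)
  with pos xab norm show thesis by (intro that)
qed

lemma geodesic_axis_coordinates:
  "geodesic (a *\<^sub>R m + b *\<^sub>R p) (b *\<^sub>R p - a *\<^sub>R m) s = (a * exp (- s)) *\<^sub>R m + (b * exp s) *\<^sub>R p"
  unfolding geodesic_def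
  by (simp add: vec_eq_iff cosh_field_def sinh_field_def field_simps)

text \<open>Both \<open>m\<close> and \<open>p\<close> are combinations of \<open>x\<close> and the tangent vector, so the wedge product is orthogonal
  to \<open>m\<close> and \<open>p\<close> and hence a multiple of \<open>z\<close>. It has length \<open>1\<close>, and the sign comes from the
  orientation of the frame.\<close>

lemma axis_tangent:
  assumes fr: "eigenframe A c m p z" and x: "x \<in> axis_of A"
  shows "B x (forward_tangent A x) = 0" "B (forward_tangent A x) (forward_tangent A x) = 1"
    "B (forward_tangent A x) z = 0" "wedge x (forward_tangent A x) = z"
proof -
  note e = eigenframeD[OF fr]
  obtain a b where ab: "a > 0" "b > 0" "x = a *\<^sub>R m + b *\<^sub>R p" "2 * a * b * B m p = -1"
    "forward_tangent A x = b *\<^sub>R p - a *\<^sub>R m"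
    by (rule axis_coordinates[OF assms])
  show 1: "B x (forward_tangent A x) = 0" "B (forward_tangent A x) (forward_tangent A x) = 1"
    "B (forward_tangent A x) z = 0"
    unfolding ab(5) unfolding ab(3) using ab(4) e by (simp_all add: B_commute[of p m])
  have xx: "B x x = -1" using x by (simp add: axis_of_def H2_iff)
  let ?t = "forward_tangent A x"
  have am: "m = (1 / (2 * a)) *\<^sub>R (x - ?t)" and bp: "p = (1 / (2 * b)) *\<^sub>R (x + ?t)"
    unfolding ab(5) unfolding ab(3) using ab(1,2) by (simp_all add: scaleR_2[symmetric])
  have "B (wedge x ?t) m = 0" "B (wedge x ?t) p = 0"
    by (subst am, simp) (subst bp, simp)
  then obtain k where k: "wedge x ?t = k *\<^sub>R z"
    using eigenframe_expand[OF fr, of "wedge x ?t"] by auto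
  have "B (wedge x ?t) (wedge x ?t) = 1"
    using 1 xx by (simp add: B_wedge_wedge)
  then have "k = 1 \<or> k = -1"
    using e(8) by (simp add: k power2_eq_1_iff flip: power2_eq_square)
  moreover have "k = B (wedge x ?t) z" using e by (simp add: k)
  moreover have "B (wedge x ?t) z = 2 * a * b * det (vector [z, m, p] :: real^3^3)"
    unfolding B_wedge ab(5) by (simp add: ab(3) det_3 algebra_simps)
  moreover have "2 * a * b * det (vector [z, m, p] :: real^3^3) > 0"
    using ab e by simp
  ultimately have "k = 1" by linarith
  then show "wedge x ?t = z" using k by simp
qed

text \<open>With \<open>x = a m + b p\<close> the geodesic is \<open>s \<mapsto> a e\<^sup>-\<^sup>s m + b e\<^sup>s p\<close>, from which all claims are read off.\<close>

lemma axis_geodesic: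
  assumes fr: "eigenframe A c m p z" and x: "x \<in> axis_of A"
  defines "\<gamma> \<equiv> geodesic x (forward_tangent A x)"
  shows "\<gamma> s \<in> axis_of A" "A *v \<gamma> s = \<gamma> (s + translation_length c)"
    "geodesic (\<gamma> s) (forward_tangent A (\<gamma> s)) s' = \<gamma> (s + s')"
    "y \<in> axis_of A \<Longrightarrow> \<exists>s. y = \<gamma> s" "\<gamma> s = \<gamma> s' \<Longrightarrow> s = s'"
proof -
  note e = eigenframeD[OF fr]
  obtain a b where ab: "a > 0" "b > 0" "x = a *\<^sub>R m + b *\<^sub>R p" "2 * a * b * B m p = -1"
    "forward_tangent A x = b *\<^sub>R p - a *\<^sub>R m"
    by (rule axis_coordinates[OF fr x])
  have \<gamma>: "\<gamma> s = (a * exp (- s)) *\<^sub>R m + (b * exp s) *\<^sub>R p" for s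
    unfolding \<gamma>_def ab(5) unfolding ab(3) by (rule geodesic_axis_coordinates)
  have ee: "exp (- s) * exp s = 1" for s :: real
    by (simp add: exp_minus)
  show ax: "\<gamma> s \<in> axis_of A" for s
  proof -
    have "B (\<gamma> s) (\<gamma> s) = 2 * a * b * B m p * (exp (- s) * exp s)"
      using e by (simp add: \<gamma> B_commute[of p m] algebra_simps)
    then show ?thesis
      using ab(1,2,4) e by (simp add: eigenframe_axis[OF fr] H2_iff ee) (simp add: \<gamma> e add_pos_pos)
  qed
  have c: "exp (- translation_length c) = c" "exp (translation_length c) = inverse c"
    using e by (simp_all add: translation_length_def exp_minus)
  show "A *v \<gamma> s = \<gamma> (s + translation_length c)"
    using e by (simp add: \<gamma> matrix_vector_right_distrib matrix_vector_mult_scaleR exp_add exp_diff c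
        divide_inverse translation_length_def exp_minus mult_ac)
  have inj: "s = s'" if "\<gamma> s = \<gamma> s'" for s s'
  proof -
    have "B m (\<gamma> s) = B m (\<gamma> s')" using that by simp
    then show ?thesis using ab e by (simp add: \<gamma>)
  qed
  then show "\<gamma> s = \<gamma> s' \<Longrightarrow> s = s'" .
  show "geodesic (\<gamma> s) (forward_tangent A (\<gamma> s)) s' = \<gamma> (s + s')"
  proof -
    obtain a' b' where ab': "\<gamma> s = a' *\<^sub>R m + b' *\<^sub>R p" "forward_tangent A (\<gamma> s) = b' *\<^sub>R p - a' *\<^sub>R m"
      by (rule axis_coordinates[OF fr ax])
    have "B m (a' *\<^sub>R m + b' *\<^sub>R p) = B m (\<gamma> s)" "B p (a' *\<^sub>R m + b' *\<^sub>R p) = B p (\<gamma> s)"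
      by (simp_all add: ab')
    then have "a' = a * exp (- s)" "b' = b * exp s"
      using e by (simp_all add: \<gamma>)
    then show ?thesis
      unfolding ab'(2) unfolding ab'(1) geodesic_axis_coordinates by (simp add: \<gamma> exp_add mult.assoc mult.left_commute exp_diff exp_minus)
        (simp add: field_simps)
  qed
  assume y: "y \<in> axis_of A"
  obtain a' b' where ab': "a' > 0" "b' > 0" "y = a' *\<^sub>R m + b' *\<^sub>R p" "2 * a' * b' * B m p = -1"
    by (rule axis_coordinates[OF fr y])
  have "a' * b' = a * b" using ab(4) ab'(4) e(15)
    by (metis mult.assoc mult_cancel_left mult_cancel_right less_irrefl zero_neq_numeral)
  then have "a' = a * (b / b')" using ab' by (simp add: field_simps)
  moreover have "exp (- ln (b' / b)) = b / b'" "exp (ln (b' / b)) = b' / b"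
    using ab ab' by (simp_all add: exp_minus)
  ultimately have "y = \<gamma> (ln (b' / b))"
    using ab ab' by (simp add: \<gamma>)
  then show "\<exists>s. y = \<gamma> s" by blast
qed

text \<open>Both \<open>z\<close> and \<open>z'\<close> arise from the forward tangent vectors by taking the wedge product with \<open>x\<close>,
  which is a quarter turn of the tangent plane at \<open>x\<close>.\<close>

lemma cos_axis_angle:
  assumes fr: "eigenframe A c m p z" "eigenframe A' c' m' p' z'"
    and x: "x \<in> axis_of A" "x \<in> axis_of A'"
  shows "cos (axis_angle A A' x) = B z z'"
proof -
  let ?t = "forward_tangent A x" and ?t' = "forward_tangent A' x"
  note t = axis_tangent[OF fr(1) x(1)] and t' = axis_tangent[OF fr(2) x(2)]
  have xx: "B x x = -1" "x$3 > 0" using x by (auto simp: axis_of_def H2_iff)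
  have "B (wedge x ?t) (wedge x ?t') = B ?t ?t'"
    unfolding B_wedge_wedge using xx t t' by simp
  then have eq: "B ?t ?t' = B z z'" by (simp only: t(4) t'(4))
  have nonneg: "B w w \<ge> 0" if "B x w = 0" for w
    using spacelike_if_orthogonal_timelike[of x w] xx that B_commute[of x w]
    by (cases "w = 0") (auto intro: less_imp_le)
  have "B (?t + ?t') (?t + ?t') \<ge> 0" "B (?t - ?t') (?t - ?t') \<ge> 0"
    by (rule nonneg, simp add: t(1) t'(1))+
  then have "\<bar>B ?t ?t'\<bar> \<le> 1"
    using t t' B_commute[of ?t ?t'] by simp
  then show ?thesis
    unfolding axis_angle_def by (simp add: cos_arccos_abs eq)
qed

section \<open>Regions bounded by geodesics\<close>

lemma convex_future_cone: "convex {v. B v v < 0 \<and> v$3 > 0}"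
proof (rule convexI)
  fix v w :: "real^3" and a b :: real
  assume vw: "v \<in> {v. B v v < 0 \<and> v$3 > 0}" "w \<in> {v. B v v < 0 \<and> v$3 > 0}"
    and ab: "0 \<le> a" "0 \<le> b" "a + b = 1"
  have "B v w < 0" using vw by (auto intro!: B_future_neg)
  show "a *\<^sub>R v + b *\<^sub>R w \<in> {v. B v v < 0 \<and> v$3 > 0}"
  proof (cases "a = 0 \<or> b = 0")
    case True
    then show ?thesis using vw ab by auto
  next
    case False
    then have "a > 0" "b > 0" using ab by auto
    then have "a * (a * B v v) < 0" "b * (b * B w w) < 0" "a * (b * B v w) < 0"
      using vw \<open>B v w < 0\<close> by (auto simp: mult_pos_neg)
    moreover have "B (a *\<^sub>R v + b *\<^sub>R w) (a *\<^sub>R v + b *\<^sub>R w)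
        = a * (a * B v v) + b * (b * B w w) + 2 * (a * (b * B v w))"
      by (simp add: B_commute[of w v] algebra_simps)
    ultimately have "B (a *\<^sub>R v + b *\<^sub>R w) (a *\<^sub>R v + b *\<^sub>R w) < 0" by linarith
    moreover have "(a *\<^sub>R v + b *\<^sub>R w)$3 > 0"
      using vw \<open>a > 0\<close> \<open>b > 0\<close> by (simp add: add_pos_pos)
    ultimately show ?thesis by simp
  qed
qed

lemma convex_halfspace_B: "convex {v. B v z > 0}"
  using convex_halfspace_gt[of 0 "flip z"] by (simp add: B_eq_inner inner_commute)

lemma connected_same_side:
  assumes "connected Q" "\<And>x. x \<in> Q \<Longrightarrow> B x z \<noteq> 0" "x \<in> Q" "y \<in> Q" "B x z > 0"
  shows "B y z > 0"
proof (rule ccontr)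
  assume "\<not> B y z > 0"
  moreover have "connected ((\<lambda>x. B x z) ` Q)"
    using assms(1) by (intro connected_continuous_image continuous_intros)
  ultimately have "0 \<in> (\<lambda>x. B x z) ` Q"
    using connectedD_interval[of "(\<lambda>x. B x z) ` Q" "B y z" "B x z" 0] assms by auto
  then show False using assms(2) by auto
qed

text \<open>A unit spacelike vector \<open>z\<close> is the normal of the geodesic on which \<open>B x z\<close> vanishes; these geodesics
  are the walls.\<close>

definition off_walls :: "(real^3) set \<Rightarrow> (real^3) set" where
  "off_walls N = {x \<in> H2. \<forall>z\<in>N. B x z \<noteq> 0}"

text \<open>A connected set that avoids a wall lies on one side of it, and so does its convex hull. The hull of
  three points of \<open>Q\<close> projects radially to a connected subset of \<open>H2\<close> that avoids all walls.\<close>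

lemma component_off_walls_convex:
  assumes Q: "Q \<in> components (off_walls N)"
    and x: "x1 \<in> Q" "x2 \<in> Q" "x3 \<in> Q"
    and a: "a1 \<ge> 0" "a2 \<ge> 0" "a3 \<ge> 0"
    and w: "w \<in> H2" "w = a1 *\<^sub>R x1 + a2 *\<^sub>R x2 + a3 *\<^sub>R x3"
  shows "w \<in> Q"
proof -
  define \<nu> :: "real^3 \<Rightarrow> real^3" where "\<nu> = (\<lambda>v. (1 / sqrt (- B v v)) *\<^sub>R v)"
  let ?K = "convex hull {x1, x2, x3}"
  have QW: "Q \<subseteq> off_walls N" and Qc: "connected Q"
    using Q in_components_subset in_components_connected by auto
  have H: "x1 \<in> H2" "x2 \<in> H2" "x3 \<in> H2"
    using x QW by (auto simp: off_walls_def)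
  have K: "?K \<subseteq> {v. B v v < 0 \<and> v$3 > 0}"
    using H by (intro hull_minimal convex_future_cone) (auto simp: H2_iff)
  have off: "B v z \<noteq> 0" if "v \<in> ?K" "z \<in> N" for v z
  proof -
    have ne: "B x z \<noteq> 0" if "x \<in> Q" for x
      using QW that \<open>z \<in> N\<close> by (auto simp: off_walls_def)
    consider "B x1 z > 0" | "B x1 (- z) > 0" using ne[OF x(1)] by fastforce
    then show ?thesis
    proof cases
      case 1
      then have "?K \<subseteq> {v. B v z > 0}"
        using connected_same_side[OF Qc, of z x1] ne x
        by (intro hull_minimal convex_halfspace_B) auto
      then show ?thesis using that by auto
    next
      case 2
      then have "?K \<subseteq> {v. B v (- z) > 0}"
        using connected_same_side[OF Qc, of "- z" x1] ne x
        by (intro hull_minimal convex_halfspace_B) auto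
      then show ?thesis using that by auto
    qed
  qed
  have "connected (\<nu> ` ?K)"
  proof (rule connected_continuous_image)
    show "continuous_on ?K \<nu>"
      unfolding \<nu>_def using K by (intro continuous_intros) auto
    show "connected ?K" by (intro convex_connected convex_convex_hull)
  qed
  moreover have "\<nu> ` ?K \<subseteq> off_walls N"
  proof clarify
    fix v assume v: "v \<in> ?K"
    then have neg: "B v v < 0" "v$3 > 0" using K by auto
    then have "B (\<nu> v) (\<nu> v) = -1"
      by (simp add: \<nu>_def power2_eq_square[symmetric] power_divide)
    then show "\<nu> v \<in> off_walls N"
      using neg off[OF v] by (auto simp: off_walls_def H2_iff \<nu>_def)
  qed
  moreover have "x1 \<in> \<nu> ` ?K"
    using H(1) by (intro image_eqI[of _ _ x1]) (auto simp: \<nu>_def H2_iff hull_inc)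
  ultimately have sub: "\<nu> ` ?K \<subseteq> Q"
    using Q x(1) by (intro components_maximal[of Q]) auto
  define S where "S = a1 + a2 + a3"
  have "S \<noteq> 0"
  proof
    assume "S = 0"
    then have "a1 = 0" "a2 = 0" "a3 = 0" using a unfolding S_def by linarith+
    then show False using w by (simp add: H2_iff)
  qed
  then have S: "S > 0" using a unfolding S_def by linarith
  have "(1 / S) *\<^sub>R w \<in> ?K"
    unfolding convex_hull_3 w(2) using a S
    by (intro CollectI exI[of _ "a1 / S"] exI[of _ "a2 / S"] exI[of _ "a3 / S"])
      (simp add: scaleR_add_right add_divide_distrib[symmetric] S_def)
  moreover have "\<nu> ((1 / S) *\<^sub>R w) = w"
    using w(1) S by (simp add: \<nu>_def H2_iff real_sqrt_divide real_sqrt_mult)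
  ultimately show ?thesis using sub by (metis image_eqI subsetD)
qed

text \<open>Relative to the coordinates of \<open>q\<close>, the points \<open>A\<^sup>n q\<close> are \<open>(c\<^sup>n, c\<^sup>-\<^sup>n, 1)\<close>, and the point \<open>w\<close>
  is a positive multiple of \<open>(X, Y, 1)\<close> with \<open>X, Y > 1\<close>. In the plane, a point with both coordinates
  larger than \<open>1\<close> lies in the triangle with vertices \<open>(1, 1)\<close>, \<open>(k, k\<^sup>-\<^sup>1)\<close>, \<open>(k\<^sup>-\<^sup>1, k)\<close> as soon as
  \<open>k = c\<^sup>N\<close> is small enough. Hence \<open>w\<close> is in the hull of \<open>q\<close>, \<open>A\<^sup>N q\<close> and \<open>A\<^sup>-\<^sup>N q\<close>.\<close>

lemma invariant_component_hull:
  assumes fr: "eigenframe A c m p z" and Q: "Q \<in> components (off_walls N)"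
    and inv: "(\<lambda>x. A *v x) ` Q = Q" and q: "q \<in> Q"
    and w: "w \<in> H2" "B w z / B q z > 0" "B w p / B q p > B w z / B q z" "B w m / B q m > B w z / B q z"
  shows "w \<in> Q"
proof -
  note e = eigenframeD[OF fr]
  have "q \<in> H2" using q in_components_subset[OF Q] by (auto simp: off_walls_def)
  note qn = eigenframe_coordinates_pos[OF fr this]
  have qz: "B q z \<noteq> 0" using w(2) by auto
  have fwd: "\<exists>y\<in>Q. B y p = c ^ n * B q p \<and> B y m = inverse (c ^ n) * B q m \<and> B y z = B q z" for n
  proof (induction n)
    case (Suc n)
    then obtain y where y: "y \<in> Q" "B y p = c ^ n * B q p" "B y m = inverse (c ^ n) * B q m" "B y z = B q z"
      by blast
    have "A *v y \<in> Q" using y(1) inv by blast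
    then show ?case
      using eigenframe_B_image[OF fr, of y] y by (intro bexI[of _ "A *v y"]) simp_all
  qed (use q in auto)
  have bwd: "\<exists>y\<in>Q. B y p = inverse (c ^ n) * B q p \<and> B y m = c ^ n * B q m \<and> B y z = B q z" for n
  proof (induction n)
    case (Suc n)
    then obtain y where y: "y \<in> Q" "B y p = inverse (c ^ n) * B q p" "B y m = c ^ n * B q m" "B y z = B q z"
      by blast
    obtain x where x: "x \<in> Q" "y = A *v x" using y(1) inv by blast
    then show ?case
      using eigenframe_B_image[OF fr, of x] y e(1) by (intro bexI[of _ x]) (simp_all add: field_simps)
  qed (use q in auto)
  \<comment> \<open>The coordinates of \<open>w\<close> relative to \<open>q\<close>, with the one along \<open>z\<close> scaled to \<open>1\<close>.\<close>
  define d X Y where "d = B w z / B q z" and "X = B w p / B q p / d" and "Y = B w m / B q m / d"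
  have d: "d > 0" using w(2) by (simp add: d_def)
  have X: "X > 1" and Y: "Y > 1"
    unfolding X_def Y_def using w(3,4)[folded d_def] d by (simp_all only: less_divide_eq_1_pos)
  have Bw: "B w z = d * B q z" "B w p = d * X * B q p" "B w m = d * Y * B q m"
    using qz qn d w(2) by (auto simp: d_def X_def Y_def)
  obtain N where N: "(1 - c ^ N)\<^sup>2 > c ^ N * (X + Y - 2)" "N > 0"
  proof -
    have "(\<lambda>n. c ^ n) \<longlonglongrightarrow> 0" using e by (intro LIMSEQ_realpow_zero) auto
    then have "(\<lambda>n. (1 - c ^ n)\<^sup>2 - c ^ n * (X + Y - 2)) \<longlonglongrightarrow> (1 - 0)\<^sup>2 - 0 * (X + Y - 2)"
      by (intro tendsto_diff tendsto_mult tendsto_const tendsto_power)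
    then have "\<forall>\<^sub>F n in sequentially. (1 - c ^ n)\<^sup>2 - c ^ n * (X + Y - 2) > 0"
      by (rule order_tendstoD) simp
    then have "\<forall>\<^sub>F n in sequentially. (1 - c ^ n)\<^sup>2 - c ^ n * (X + Y - 2) > 0 \<and> n > 0"
      using eventually_gt_at_top[of 0] by eventually_elim simp
    then show thesis using that by (auto dest!: eventually_happens)
  qed
  define k where "k = c ^ N"
  have k: "0 < k" "k < 1"
    using e N(2) by (auto simp: k_def power_less_one_iff)
  define D where "D = (1 - k)\<^sup>2 * (1 + k)"
  have D: "D > 0" using k by (simp add: D_def)
  \<comment> \<open>Barycentric coordinates of \<open>(X, Y)\<close> with respect to \<open>(k, 1/k)\<close>, \<open>(1/k, k)\<close> and \<open>(1, 1)\<close>.\<close>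
  define a1 a2 where "a1 = k * ((Y - 1) + k * (X - 1)) / D" and "a2 = k * ((X - 1) + k * (Y - 1)) / D"
  have sum: "a1 + a2 = k * (X + Y - 2) / (1 - k)\<^sup>2"
  proof -
    have "a1 + a2 = (k * (X + Y - 2) * (1 + k)) / D"
      by (simp add: a1_def a2_def add_divide_distrib[symmetric] algebra_simps)
    then show ?thesis using k by (simp add: D_def)
  qed
  define a3 where "a3 = 1 - (a1 + a2)"
  have a: "a1 \<ge> 0" "a2 \<ge> 0"
    using k X Y D by (simp_all add: a1_def a2_def)
  have "a3 \<ge> 0"
    using N(1) k unfolding a3_def sum by (simp add: k_def[symmetric] divide_le_eq_1)
  have kk: "a1 * k + a2 * inverse k + a3 = X" if "a1 = k * ((Y - 1) + k * (X - 1)) / D" 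
      "a2 = k * ((X - 1) + k * (Y - 1)) / D" "a3 = 1 - (a1 + a2)" for a1 a2 a3 X Y
  proof -
    have "a1 * k + a2 * inverse k + a3 = 1 + (1 - k) * (a2 / k - a1)"
      using k unfolding that(3) by (simp add: field_simps)
    also have "a2 / k - a1 = (((X - 1) + k * (Y - 1)) - k * ((Y - 1) + k * (X - 1))) / D"
      using k by (simp add: that diff_divide_distrib)
    also have "\<dots> = ((1 - k) * (1 + k) * (X - 1)) / D"
      by (simp add: algebra_simps)
    also have "\<dots> = (X - 1) / (1 - k)"
      using k by (simp add: D_def power2_eq_square)
    finally show ?thesis using k by simp
  qed
  have eX: "a1 * k + a2 * inverse k + a3 = X"
    by (rule kk[OF a1_def a2_def a3_def])
  have eY: "a2 * k + a1 * inverse k + a3 = Y"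
    using kk[OF a2_def a1_def] by (simp add: a3_def add.commute)
  obtain y1 where y1: "y1 \<in> Q" "B y1 p = k * B q p" "B y1 m = inverse k * B q m" "B y1 z = B q z"
    using fwd[of N] by (auto simp: k_def)
  obtain y2 where y2: "y2 \<in> Q" "B y2 p = inverse k * B q p" "B y2 m = k * B q m" "B y2 z = B q z"
    using bwd[of N] by (auto simp: k_def)
  have "w = (d * a1) *\<^sub>R y1 + (d * a2) *\<^sub>R y2 + (d * a3) *\<^sub>R q"
  proof (rule eigenframe_eqI[OF fr])
    show "B w m = B ((d * a1) *\<^sub>R y1 + (d * a2) *\<^sub>R y2 + (d * a3) *\<^sub>R q) m"
      unfolding Bw eY[symmetric] by (simp add: y1 y2 algebra_simps)
    show "B w p = B ((d * a1) *\<^sub>R y1 + (d * a2) *\<^sub>R y2 + (d * a3) *\<^sub>R q) p"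
      unfolding Bw eX[symmetric] by (simp add: y1 y2 algebra_simps)
    show "B w z = B ((d * a1) *\<^sub>R y1 + (d * a2) *\<^sub>R y2 + (d * a3) *\<^sub>R q) z"
      unfolding Bw by (simp add: y1 y2 a3_def algebra_simps)
  qed
  with a \<open>a3 \<ge> 0\<close> d show ?thesis
    by (intro component_off_walls_convex[OF Q y1(1) y2(1) q _ _ _ w(1)]) auto
qed

lemma continuous_geodesic [continuous_intros]: "continuous_on S (geodesic x v)"
  unfolding geodesic_def[abs_def] by (intro continuous_intros)

lemma geodesic_0 [simp]: "geodesic x v 0 = x"
  by (simp add: geodesic_def)

lemma tendsto_geodesic_at_right: "(geodesic x v \<longlongrightarrow> x) (at_right 0)"
  using continuous_geodesic[of UNIV x v] unfolding continuous_on_def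
  by (metis UNIV_I at_within_le_nhds filterlim_mono geodesic_0 order_refl subset_UNIV at_le)

text \<open>An invariant component reaches the whole axis from its own side: in the coordinates relative to \<open>q\<close>,
  the one along \<open>z\<close> is \<open>0\<close> at \<open>x\<close> and the other two are positive, so close to \<open>x\<close> it is the smallest.\<close>

lemma invariant_component_germ:
  assumes fr: "eigenframe A c m p z" and Q: "Q \<in> components (off_walls N)"
    and inv: "(\<lambda>x. A *v x) ` Q = Q" and q: "q \<in> Q"
    and x: "x \<in> axis_of A" and v: "B x v = 0" "B v v = 1" "B v z / B q z > 0"
  shows "\<forall>\<^sub>F s in at_right 0. geodesic x v s \<in> Q"
proof -
  note e = eigenframeD[OF fr]
  have "q \<in> H2" using q in_components_subset[OF Q] by (auto simp: off_walls_def)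
  note qn = eigenframe_coordinates_pos[OF fr this]
  have xH: "x \<in> H2" and xz: "B x z = 0" using x eigenframe_axis[OF fr] by auto
  note xn = eigenframe_coordinates_pos[OF fr xH]
  have lim: "((\<lambda>s. B (geodesic x v s) y) \<longlongrightarrow> B x y) (at_right 0)" for y
    unfolding B_def by (intro tendsto_intros tendsto_geodesic_at_right)
  have less: "\<forall>\<^sub>F s in at_right 0. B (geodesic x v s) z / B q z < B (geodesic x v s) y / B q y"
    if "B q y < 0" "B x y < 0" for y
  proof -
    have "((\<lambda>s. B (geodesic x v s) y / B q y - B (geodesic x v s) z / B q z) \<longlongrightarrow>
      B x y / B q y - B x z / B q z) (at_right 0)"
      using that v(3) by (intro tendsto_intros lim) auto
    then have "\<forall>\<^sub>F s in at_right 0. B (geodesic x v s) y / B q y - B (geodesic x v s) z / B q z > 0"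
      by (rule order_tendstoD) (use that xz in \<open>simp add: divide_neg_neg\<close>)
    then show ?thesis by eventually_elim simp
  qed
  have "\<forall>\<^sub>F s in at_right 0. geodesic x v s $ 3 > 0"
    using tendsto_vec_nth[OF tendsto_geodesic_at_right, of x v 3] xH
    by (intro order_tendstoD(1)[of _ "x$3"]) (auto simp: H2_iff)
  with less[OF qn(2) xn(2)] less[OF qn(1) xn(1)] eventually_at_right_less
  show ?thesis
  proof eventually_elim
    case (elim s)
    have "B (geodesic x v s) (geodesic x v s) = (sinh s)\<^sup>2 - (cosh s)\<^sup>2"
      using v xH B_commute[of v x] by (simp add: geodesic_def H2_iff power2_eq_square)
    also have "\<dots> = -1" by (simp add: cosh_square_eq)
    finally have "geodesic x v s \<in> H2" using elim by (simp add: H2_iff)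
    moreover have "B (geodesic x v s) z / B q z > 0"
    proof -
      have "B (geodesic x v s) z / B q z = sinh s * (B v z / B q z)"
        using xz by (simp add: geodesic_def)
      moreover have "sinh s > 0" using elim by simp
      ultimately show ?thesis using v(3) by (simp only: mult_pos_pos)
    qed
    ultimately show ?case
      using elim by (intro invariant_component_hull[OF fr Q inv q]) auto
  qed
qed

text \<open>Two invariant components on the same side of the axis would both contain the points close to it on
  that side. Distinct ones therefore lie on opposite sides, and \<open>v\<close> points into one of them.\<close>

lemma adjacent_component_germ:
  assumes fr: "eigenframe A c m p z" and z: "z \<in> N"
    and Q: "Q \<in> components (off_walls N)" "Q' \<in> components (off_walls N)" "Q \<noteq> Q'"
    and inv: "(\<lambda>x. A *v x) ` Q = Q" "(\<lambda>x. A *v x) ` Q' = Q'"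
    and x: "x \<in> axis_of A" and v: "B x v = 0" "B v v = 1" "B v z \<noteq> 0"
  shows "(\<forall>\<^sub>F s in at_right 0. geodesic x v s \<in> Q) \<or> (\<forall>\<^sub>F s in at_right 0. geodesic x v s \<in> Q')"
proof (rule ccontr)
  assume no: "\<not> ?thesis"
  obtain q q' where q: "q \<in> Q" "q' \<in> Q'"
    using Q in_components_nonempty by blast
  have qz: "B q z \<noteq> 0" "B q' z \<noteq> 0"
    using q Q(1,2)[THEN in_components_subset] z by (auto simp: off_walls_def)
  have "\<not> B v z / B q z > 0" "\<not> B v z / B q' z > 0"
    using no invariant_component_germ[OF fr Q(1) inv(1) q(1) x v(1,2)]
      invariant_component_germ[OF fr Q(2) inv(2) q(2) x v(1,2)] by blast+
  then have "B (- v) z / B q z > 0" "B (- v) z / B q' z > 0"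
    using qz v(3) by (auto simp: zero_less_divide_iff divide_less_0_iff)
  then have "\<forall>\<^sub>F s in at_right 0. geodesic x (- v) s \<in> Q" "\<forall>\<^sub>F s in at_right 0. geodesic x (- v) s \<in> Q'"
    using invariant_component_germ[OF fr Q(1) inv(1) q(1) x, of "- v"]
      invariant_component_germ[OF fr Q(2) inv(2) q(2) x, of "- v"] v by auto
  then have "\<forall>\<^sub>F s in at_right (0::real). Q \<inter> Q' \<noteq> {}"
    by eventually_elim blast
  then have "Q \<inter> Q' \<noteq> {}" by (simp add: eventually_const_iff)
  then show False using Q components_nonoverlap by blast
qed

section \<open>The regions of the pants decomposition\<close>

lemma Gb_isometries:
  assumes "surface_group b g"
  shows "Gb b g \<subseteq> isometries"
proof -
  have "g ` {1..b+1} \<subseteq> isometries"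
    using assms SO0_subset_isometries unfolding surface_group_def hyperbolic_def by auto
  then show ?thesis unfolding Gb_def by (rule generated_isometries)
qed

lemma Gb_closed:
  shows Gb_one: "mat 1 \<in> Gb b g"
    and Gb_mult: "A \<in> Gb b g \<Longrightarrow> A' \<in> Gb b g \<Longrightarrow> A ** A' \<in> Gb b g"
    and Gb_inv: "A \<in> Gb b g \<Longrightarrow> matrix_inv A \<in> Gb b g"
  unfolding Gb_def by (simp_all add: generated_closed)

lemma axis_conj:
  assumes fr: "eigenframe A c m p z" and D: "D \<in> isometries"
  shows "(\<lambda>x. D *v x) ` axis_of A = axis_of (D ** A ** matrix_inv D)"
    "axis_of (D ** A ** matrix_inv D) = {x \<in> H2. B x (D *v z) = 0}"
proof -
  show 2: "axis_of (D ** A ** matrix_inv D) = {x \<in> H2. B x (D *v z) = 0}"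
    by (rule eigenframe_axis[OF eigenframe_conj[OF fr D]])
  show "(\<lambda>x. D *v x) ` axis_of A = axis_of (D ** A ** matrix_inv D)"
    unfolding 2 eigenframe_axis[OF fr]
  proof safe
    fix x assume "x \<in> H2" "B x z = 0"
    then show "D *v x \<in> H2" "B (D *v x) (D *v z) = 0"
      using D by (simp_all add: isometry_H2 B_isometry)
  next
    fix y assume y: "y \<in> H2" "B y (D *v z) = 0"
    have "B (matrix_inv D *v y) z = 0"
      using y(2) B_isometry[OF D, of "matrix_inv D *v y" z] D by simp
    moreover have "matrix_inv D *v y \<in> H2"
      using y D by (intro isometry_H2 isometries_inv)
    ultimately show "y \<in> (\<lambda>x. D *v x) ` {x \<in> H2. B x z = 0}"
      using D by (intro image_eqI[of _ _ "matrix_inv D *v y"]) simp_all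
  qed
qed

lemma Xzero_eigenframe:
  assumes "hyperbolic A"
  obtains c m p where "eigenframe A c m p (Xzero A)"
  using hyperbolic_eigenframe[OF assms] eigenframe_Xzero by metis

lemma orbit_eqD:
  assumes "orbit (Gb b g) x = orbit (Gb b g) y"
  obtains D where "D \<in> Gb b g" "x = D *v y"
proof -
  have "x \<in> orbit (Gb b g) x"
    unfolding orbit_def using Gb_one by (intro image_eqI[of _ _ "mat 1"]) auto
  then show thesis using assms that by (auto simp: orbit_def)
qed

lemma orbit_image:
  assumes "Gb b g \<subseteq> isometries" "D \<in> Gb b g"
  shows "orbit (Gb b g) (D *v x) = orbit (Gb b g) x"
proof -
  have D: "D \<in> isometries" using assms by blast
  show ?thesis
    unfolding orbit_def
  proof safe
    fix A assume "A \<in> Gb b g"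
    then show "A *v (D *v x) \<in> (\<lambda>A. A *v x) ` Gb b g"
      using Gb_mult[OF _ assms(2)] by (auto simp: matrix_vector_mul_assoc)
    have "A *v x = (A ** matrix_inv D) *v (D *v x)"
      using D by (simp flip: matrix_vector_mul_assoc)
    then show "A *v x \<in> (\<lambda>A. A *v (D *v x)) ` Gb b g"
      using Gb_mult[OF \<open>A \<in> Gb b g\<close> Gb_inv[OF assms(2)]] by blast
  qed
qed

text \<open>The powers of \<open>f\<close> act on its axis as translations by multiples of \<open>L\<close>. The first claim turns
  membership in \<open>generated {f}\<close>, as it occurs in the definition of a simple closed geodesic, into a
  number of periods; the second provides all powers of \<open>f\<close>, negative ones included.\<close>

lemma generated_singleton_shift:
  assumes fr: "eigenframe f c m p z" and f: "f \<in> isometries" and x: "x \<in> axis_of f"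
  defines "\<gamma> \<equiv> geodesic x (forward_tangent f x)" and "L \<equiv> translation_length c"
  shows "D \<in> generated {f} \<Longrightarrow> \<exists>n::int. \<forall>s. D *v \<gamma> s = \<gamma> (s + n * L)"
    and "\<exists>D\<in>generated {f}. (\<forall>s. D *v \<gamma> s = \<gamma> (s + of_int n * L)) \<and> D *v z = z"
proof -
  note e = eigenframeD[OF fr]
  have f1: "f *v \<gamma> s = \<gamma> (s + L)" for s
    unfolding \<gamma>_def L_def by (rule axis_geodesic(2)[OF fr x])
  have finv: "matrix_inv f *v \<gamma> s = \<gamma> (s - L)" "matrix_inv f *v z = z" for s
    using f1[of "s - L"] f e(5) isometry_inv(4)[OF f, of "\<gamma> (s - L)"] isometry_inv(4)[OF f, of z] by simp_all
  have "generated {f} \<subseteq> {D \<in> isometries. \<exists>n::int. \<forall>s. D *v \<gamma> s = \<gamma> (s + n * L)}" (is "_ \<subseteq> ?H")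
  proof (rule generated_minimal)
    show "{f} \<subseteq> ?H" using f f1 by (auto intro!: exI[of _ 1])
    show "mat 1 \<in> ?H" by (auto intro!: exI[of _ 0] isometries_one)
  next
    fix D D' assume "D \<in> ?H" "D' \<in> ?H"
    then obtain n n' :: int where D: "D \<in> isometries" "\<And>s. D *v \<gamma> s = \<gamma> (s + n * L)"
      and D': "D' \<in> isometries" "\<And>s. D' *v \<gamma> s = \<gamma> (s + n' * L)" by auto
    then show "D ** D' \<in> ?H"
      by (auto intro!: exI[of _ "n + n'"] isometries_mult simp flip: matrix_vector_mul_assoc)
        (simp add: algebra_simps)
  next
    fix D assume "D \<in> ?H"
    then obtain n :: int where D: "D \<in> isometries" "\<And>s. D *v \<gamma> s = \<gamma> (s + n * L)" by auto
    have "matrix_inv D *v \<gamma> s = \<gamma> (s + of_int (- n) * L)" for s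
      using D(2)[of "s - n * L"] isometry_inv(4)[OF D(1), of "\<gamma> (s - n * L)"] by simp
    then show "matrix_inv D \<in> ?H" using D(1) isometries_inv by blast
  qed
  then show "D \<in> generated {f} \<Longrightarrow> \<exists>n::int. \<forall>s. D *v \<gamma> s = \<gamma> (s + n * L)"
    by auto
  show "\<exists>D\<in>generated {f}. (\<forall>s. D *v \<gamma> s = \<gamma> (s + of_int n * L)) \<and> D *v z = z"
  proof (induction n rule: int_induct[where k = 0])
    case base
    show ?case by (intro bexI[of _ "mat 1"] generated_one) auto
  next
    case (step1 i)
    then obtain D where D: "D \<in> generated {f}" "\<And>s. D *v \<gamma> s = \<gamma> (s + i * L)" "D *v z = z" by blast
    show ?case
    proof (intro bexI conjI allI)
      show "f ** D \<in> generated {f}" using D(1) by (simp add: generated_mult generated_superset)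
      show "f ** D *v \<gamma> s = \<gamma> (s + of_int (i + 1) * L)" for s
        unfolding matrix_vector_mul_assoc[symmetric] D f1 by (simp add: algebra_simps)
      show "f ** D *v z = z"
        using D e by (simp flip: matrix_vector_mul_assoc)
    qed
  next
    case (step2 i)
    then obtain D where D: "D \<in> generated {f}" "\<And>s. D *v \<gamma> s = \<gamma> (s + i * L)" "D *v z = z" by blast
    show ?case
    proof (intro bexI conjI allI)
      show "matrix_inv f ** D \<in> generated {f}"
        using D(1) by (simp add: generated_mult generated_inv generated_superset)
      show "matrix_inv f ** D *v \<gamma> s = \<gamma> (s + of_int (i - 1) * L)" for s
        unfolding matrix_vector_mul_assoc[symmetric] D finv by (simp add: algebra_simps)
      show "matrix_inv f ** D *v z = z"
        using D finv by (simp flip: matrix_vector_mul_assoc)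
    qed
  qed
qed

locale decomposed_surface =
  fixes b :: nat and g :: "nat \<Rightarrow> real^3^3" and R :: "nat \<Rightarrow> (real^3) set"
  assumes b: "b \<ge> 3" and G: "surface_group b g" and pants: "pants_decomposition b g R"
begin

abbreviation \<Gamma> :: "(real^3^3) set" where "\<Gamma> \<equiv> Gb b g"

lemma iso: "C \<in> \<Gamma> \<Longrightarrow> C \<in> isometries"
  using Gb_isometries[OF G] by blast

lemma hcurve_eigenframe:
  assumes "k \<in> {1..b-2}"
  obtains c m p where "eigenframe (hcurve g k) c m p (Xzero (hcurve g k))"
  using pants assms Xzero_eigenframe unfolding pants_decomposition_def simple_closed_geodesic_def by metis

definition walls :: "(real^3) set" where
  "walls = {C *v Xzero (hcurve g k) | C k. C \<in> \<Gamma> \<and> k \<in> {1..b-2}}"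

lemma complement_dividing_lifts: "H2 - dividing_lifts b g = off_walls walls"
proof -
  have "(\<lambda>x. C *v x) ` axis_of (hcurve g k) = {x \<in> H2. B x (C *v Xzero (hcurve g k)) = 0}"
    if C: "C \<in> \<Gamma>" and k: "k \<in> {1..b-2}" for C k
  proof -
    obtain c m p where "eigenframe (hcurve g k) c m p (Xzero (hcurve g k))"
      using hcurve_eigenframe[OF k] .
    from axis_conj[OF this iso[OF C]] show ?thesis by simp
  qed
  then have "dividing_lifts b g = (\<Union>k\<in>{1..b-2}. \<Union>C\<in>\<Gamma>. {x \<in> H2. B x (C *v Xzero (hcurve g k)) = 0})"
    unfolding dividing_lifts_def by simp
  then show ?thesis unfolding off_walls_def walls_def by blast
qed

lemma off_walls_image:
  assumes "C \<in> \<Gamma>" "x \<in> off_walls walls"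
  shows "C *v x \<in> off_walls walls"
proof -
  have C: "C \<in> isometries" by (rule iso[OF assms(1)])
  have "B (C *v x) z \<noteq> 0" if "z \<in> walls" for z
  proof -
    from that obtain D k where z: "z = D *v Xzero (hcurve g k)" "D \<in> \<Gamma>" "k \<in> {1..b-2}"
      by (auto simp: walls_def)
    have "B (C *v x) z = B x (matrix_inv C *v z)"
      using B_isometry[OF C, of x "matrix_inv C *v z"] C by simp
    moreover have "matrix_inv C *v z \<in> walls"
      using z Gb_mult[OF Gb_inv[OF assms(1)] z(2)] unfolding walls_def
      by (auto simp: matrix_vector_mul_assoc)
    ultimately show ?thesis using assms(2) by (auto simp: off_walls_def)
  qed
  then show ?thesis using assms(2) isometry_H2[OF C] by (auto simp: off_walls_def)
qed

lemma component_image: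
  assumes C: "C \<in> \<Gamma>" and Q: "Q \<in> components (off_walls walls)"
  shows "(\<lambda>x. C *v x) ` Q \<in> components (off_walls walls)"
  unfolding in_components_maximal
proof (intro conjI allI impI)
  let ?C = "\<lambda>x. C *v x" and ?D = "\<lambda>x. matrix_inv C *v x"
  have cont: "continuous_on S (\<lambda>x. A *v x)" for S and A :: "real^3^3"
    by (intro linear_continuous_on) (rule matrix_vector_mul_bounded_linear)
  show "?C ` Q \<noteq> {}" using in_components_nonempty[OF Q] by blast
  show "?C ` Q \<subseteq> off_walls walls" using in_components_subset[OF Q] off_walls_image[OF C] by blast
  show "connected (?C ` Q)" by (rule connected_continuous_image[OF cont in_components_connected[OF Q]])
  fix S assume S: "S \<noteq> {} \<and> ?C ` Q \<subseteq> S \<and> S \<subseteq> off_walls walls \<and> connected S"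
  have inv: "?D (?C x) = x" "?C (?D x) = x" for x using iso[OF C] by simp_all
  have "Q \<subseteq> ?D ` S"
  proof
    fix q assume "q \<in> Q"
    then have "?C q \<in> S" using S by blast
    then show "q \<in> ?D ` S" using inv(1)[of q] by (metis image_eqI)
  qed
  moreover have "?D ` S \<subseteq> off_walls walls" using S off_walls_image[OF Gb_inv[OF C]] by blast
  moreover have "connected (?D ` S)" using S by (intro connected_continuous_image[OF cont]) auto
  moreover have "?D ` S \<noteq> {}" using S by blast
  ultimately have "?D ` S = Q"
    using Q[unfolded in_components_maximal, THEN conjunct2, THEN conjunct2, THEN conjunct2, rule_format]
    by (simp only: simp_thms)
  then show "S = ?C ` Q"
    using inv(2) by (auto simp: image_iff)
qed

lemma R_component: "m \<in> {1..b-1} \<Longrightarrow> R m \<in> components (off_walls walls)"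
  using pants unfolding pants_decomposition_def complement_dividing_lifts by blast

lemma translate_component:
  "C \<in> \<Gamma> \<Longrightarrow> m \<in> {1..b-1} \<Longrightarrow> (\<lambda>x. C *v x) ` R m \<in> components (off_walls walls)"
  by (intro component_image R_component)

text \<open>Intersecting components coincide, and every component is a translate of exactly one \<open>R m\<close>.\<close>

lemma translates_meet:
  assumes "C \<in> \<Gamma>" "m \<in> {1..b-1}" "D \<in> \<Gamma>" "n \<in> {1..b-1}"
    and "x \<in> (\<lambda>x. C *v x) ` R m" "x \<in> (\<lambda>x. D *v x) ` R n"
  shows "(\<lambda>x. C *v x) ` R m = (\<lambda>x. D *v x) ` R n" "m = n"
proof -
  show eq: "(\<lambda>x. C *v x) ` R m = (\<lambda>x. D *v x) ` R n"
    using components_nonoverlap[OF translate_component[OF assms(1,2)] translate_component[OF assms(3,4)]]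
      assms(5,6) by blast
  define P where "P k \<longleftrightarrow> k \<in> {1..b-1} \<and> (\<exists>C'\<in>\<Gamma>. (\<lambda>x. C *v x) ` R m = (\<lambda>x. C' *v x) ` R k)" for k
  have "\<exists>!k. P k"
    unfolding P_def
    by (rule pants[unfolded pants_decomposition_def complement_dividing_lifts, THEN conjunct2,
          THEN conjunct2, THEN conjunct2, rule_format, OF translate_component[OF assms(1,2)]])
  moreover have "P m" unfolding P_def by (intro conjI assms(2) bexI[OF HOL.refl assms(1)])
  moreover have "P n" unfolding P_def by (rule conjI[OF assms(4)], rule bexI[of _ D]) (rule eq, rule assms(3))
  ultimately show "m = n" by blast
qed

lemma pants_group_stabilizer:
  assumes "m \<in> {1..b-1}"
  shows "C \<in> pants_group b g m \<longleftrightarrow> C \<in> \<Gamma> \<and> (\<lambda>x. C *v x) ` R m = R m"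
  using pants assms unfolding pants_decomposition_def by blast

lemma hcurve_pants_group:
  assumes "l \<in> {1..b-2}"
  shows "hcurve g l \<in> pants_group b g l" "hcurve g l \<in> pants_group b g (l + 1)"
proof -
  show "hcurve g l \<in> pants_group b g l"
    using assms b unfolding pants_group_def by (auto intro!: generated_superset)
  have "l + 1 = b - 1 \<Longrightarrow> b - 2 = l" "l \<noteq> 0" using assms by auto
  then show "hcurve g l \<in> pants_group b g (l + 1)"
    unfolding pants_group_def by (auto intro!: generated_superset)
qed

text \<open>The element \<open>hcurve g l\<close> lies in both adjacent pants groups, so it preserves \<open>R l\<close> and \<open>R (l + 1)\<close>,
  and these are the regions on the two sides of its axis. After translation by \<open>C\<^sup>-\<^sup>1\<close> a geodesic that
  leaves the wall enters one of the two; since they are not translates of each other, the index of the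
  region in the quotient decides which one.\<close>

lemma crossing_germ:
  assumes l: "l \<in> {1..b-2}" and m: "m = l \<or> m = l + 1"
    and C: "C \<in> \<Gamma>" "x \<in> axis_of (C ** hcurve g l ** matrix_inv C)"
    and v: "B x v = 0" "B v v = 1"
    and germ: "\<forall>\<^sub>F s in at_right 0. orbit \<Gamma> (geodesic x v s) \<in> orbit \<Gamma> ` R m"
  shows "\<forall>\<^sub>F s in at_right 0. geodesic x v s \<in> (\<lambda>x. C *v x) ` R m"
proof -
  let ?h = "hcurve g l"
  obtain c hm hp where fr: "eigenframe ?h c hm hp (Xzero ?h)"
    using hcurve_eigenframe[OF l] .
  have Ci: "C \<in> isometries" and C'i: "matrix_inv C \<in> isometries"
    using iso[OF C(1)] by (auto intro: isometries_inv)
  have ml: "m \<in> {1..b-1}" "l \<in> {1..b-1}" "l + 1 \<in> {1..b-1}" using l m b by auto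
  have germ': "\<forall>\<^sub>F s in at_right 0. \<exists>D\<in>\<Gamma>. geodesic x v s \<in> (\<lambda>x. D *v x) ` R m"
    using germ
  proof eventually_elim
    case (elim s)
    then obtain q where "q \<in> R m" "orbit \<Gamma> (geodesic x v s) = orbit \<Gamma> q" by blast
    then show ?case using orbit_eqD by blast
  qed
  define x0 v0 where "x0 = matrix_inv C *v x" and "v0 = matrix_inv C *v v"
  have geo: "geodesic x v s = C *v geodesic x0 v0 s" for s
    using Ci by (simp add: x0_def v0_def geodesic_def matrix_vector_right_distrib matrix_vector_mult_scaleR)
  have x0: "x0 \<in> axis_of ?h"
    using C(2) Ci unfolding axis_conj(1)[OF fr Ci, symmetric] x0_def by auto
  have v0: "B x0 v0 = 0" "B v0 v0 = 1"
    using v C'i by (simp_all add: x0_def v0_def B_isometry)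
  have wall: "Xzero ?h \<in> walls"
    using l Gb_one[of b g] unfolding walls_def by (intro CollectI exI[of _ "mat 1"] exI[of _ l]) simp
  have "B v0 (Xzero ?h) \<noteq> 0"
  proof
    assume "B v0 (Xzero ?h) = 0"
    then have "B (geodesic x0 v0 s) (Xzero ?h) = 0" for s
      using x0 eigenframe_axis[OF fr] by (simp add: geodesic_def)
    then have "geodesic x0 v0 s \<notin> off_walls walls" for s
      using wall by (auto simp: off_walls_def)
    moreover obtain s D where "D \<in> \<Gamma>" "geodesic x v s \<in> (\<lambda>x. D *v x) ` R m"
      using eventually_happens[OF germ'] by auto
    then have "geodesic x v s \<in> off_walls walls"
      using in_components_subset[OF translate_component] ml(1) by blast
    then have "matrix_inv C *v geodesic x v s \<in> off_walls walls"
      by (intro off_walls_image Gb_inv C)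
    then have "geodesic x0 v0 s \<in> off_walls walls"
      using Ci by (simp add: geo)
    ultimately show False by blast
  qed
  moreover have "R l \<noteq> R (l + 1)"
  proof
    assume eq: "R l = R (l + 1)"
    obtain q where "q \<in> R l" using in_components_nonempty[OF R_component[OF ml(2)]] by blast
    then show False
      using translates_meet(2)[OF Gb_one ml(2) Gb_one ml(3), of q] eq by simp
  qed
  ultimately have "(\<forall>\<^sub>F s in at_right 0. geodesic x0 v0 s \<in> R l) \<or> (\<forall>\<^sub>F s in at_right 0. geodesic x0 v0 s \<in> R (l + 1))"
    using hcurve_pants_group[OF l] pants_group_stabilizer ml
    by (intro adjacent_component_germ[OF fr wall R_component R_component _ _ _ x0 v0]) auto
  then obtain m' where m': "m' \<in> {1..b-1}" "\<forall>\<^sub>F s in at_right 0. geodesic x0 v0 s \<in> R m'"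
    using ml by blast
  then have C': "\<forall>\<^sub>F s in at_right 0. geodesic x v s \<in> (\<lambda>x. C *v x) ` R m'"
    unfolding geo by (auto elim: eventually_mono)
  from eventually_conj[OF this germ'] obtain s D where
    "geodesic x v s \<in> (\<lambda>x. C *v x) ` R m'" "D \<in> \<Gamma>" "geodesic x v s \<in> (\<lambda>x. D *v x) ` R m"
    by (auto dest!: eventually_happens)
  then have "m' = m" using translates_meet(2)[OF C(1) m'(1) _ ml(1)] by blast
  with C' show ?thesis by simp
qed

section \<open>Closed geodesics that cross one dividing curve twice\<close>

text \<open>Between two crossings the axis of \<open>f\<close> stays in a single region.\<close>

lemma translates_eq_along_path:
  fixes \<gamma> :: "real \<Rightarrow> real^3"
  assumes C: "C \<in> \<Gamma>" "D \<in> \<Gamma>" and m: "m \<in> {1..b-1}" "n \<in> {1..b-1}"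
    and \<gamma>: "continuous_on {u<..<w} \<gamma>" "\<gamma> ` {u<..<w} \<subseteq> off_walls walls"
    and s: "s \<in> {u<..<w}" "\<gamma> s \<in> (\<lambda>x. C *v x) ` R m"
    and s': "s' \<in> {u<..<w}" "\<gamma> s' \<in> (\<lambda>x. D *v x) ` R n"
  shows "(\<lambda>x. C *v x) ` R m = (\<lambda>x. D *v x) ` R n"
proof -
  have "connected (\<gamma> ` {u<..<w})"
    by (intro connected_continuous_image \<gamma>(1) connected_Ioo)
  moreover have "(\<lambda>x. C *v x) ` R m \<inter> \<gamma> ` {u<..<w} \<noteq> {}"
    using s by blast
  ultimately have "\<gamma> ` {u<..<w} \<subseteq> (\<lambda>x. C *v x) ` R m"
    by (intro components_maximal[OF translate_component[OF C(1) m(1)] _ \<gamma>(2)])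
  then show ?thesis using translates_meet(1)[OF C(1) m(1) C(2) m(2)] s' by blast
qed

lemma stabilizer_quotient:
  assumes "C \<in> \<Gamma>" "D \<in> \<Gamma>" "m \<in> {1..b-1}" "(\<lambda>x. C *v x) ` R m = (\<lambda>x. D *v x) ` R m"
  shows "matrix_inv D ** C \<in> pants_group b g m"
proof -
  have "(\<lambda>x. (matrix_inv D ** C) *v x) ` R m = (\<lambda>x. matrix_inv D *v x) ` ((\<lambda>x. C *v x) ` R m)"
    by (simp add: image_image matrix_vector_mul_assoc)
  also have "\<dots> = R m"
    unfolding assms(4) using iso[OF assms(2)] by (simp add: image_image)
  finally show ?thesis
    using assms by (simp add: pants_group_stabilizer Gb_mult Gb_inv)
qed

text \<open>The walls that the axis of \<open>f\<close> meets are lifts of \<open>h\<^sub>l\<close> only, and as the closed geodesic is simple they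
  are met exactly at the translates of \<open>x\<close> and \<open>y\<close> under powers of \<open>f\<close>. Let \<open>F\<close> be the power for which
  \<open>F y\<close> lies between \<open>x\<close> and \<open>f x\<close>. From \<open>x\<close> to \<open>F y\<close> the axis runs through a region which is
  \<open>C R\<^sub>l\<^sub>+\<^sub>1\<close> as seen from \<open>x\<close> and \<open>F C' R\<^sub>l\<^sub>+\<^sub>1\<close> as seen from \<open>F y\<close>. From \<open>F y\<close> to \<open>f x\<close> it runs through
  \<open>F C' R\<^sub>l = f C R\<^sub>l\<close>. The elements that compare the two descriptions stabilize \<open>R\<^sub>l\<^sub>+\<^sub>1\<close> and \<open>R\<^sub>l\<close>.\<close>

lemma two_crossings_factorization:
  assumes l: "l \<in> {1..b-2}"
    and f: "f \<in> \<Gamma>" "simple_closed_geodesic \<Gamma> f"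
    and disjoint: "\<And>k. k \<in> {1..b-2} \<Longrightarrow> k \<noteq> l \<Longrightarrow>
          closed_geodesic \<Gamma> f \<inter> closed_geodesic \<Gamma> (hcurve g k) = {}"
    and twice: "closed_geodesic \<Gamma> f \<inter> closed_geodesic \<Gamma> (hcurve g l) = {orbit \<Gamma> x, orbit \<Gamma> y}"
      "orbit \<Gamma> x \<noteq> orbit \<Gamma> y"
    and x: "passes_at \<Gamma> f (R l) (R (l+1)) x"
    and y: "passes_at \<Gamma> f (R (l+1)) (R l) y"
    and C: "C \<in> \<Gamma>" "x \<in> axis_of (C ** hcurve g l ** matrix_inv C)"
    and C': "C' \<in> \<Gamma>" "y \<in> axis_of (C' ** hcurve g l ** matrix_inv C')"
  obtains F p q where "F \<in> \<Gamma>" "F *v Xzero f = Xzero f" "p \<in> pants_group b g l" "q \<in> pants_group b g (l+1)"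
    "f ** C = (F ** C') ** p" "C = (F ** C') ** q"
proof -
  have hyp: "hyperbolic f" using f(2) by (simp add: simple_closed_geodesic_def)
  obtain c fm fp where fr: "eigenframe f c fm fp (Xzero f)"
    using Xzero_eigenframe[OF hyp] .
  note e = eigenframeD[OF fr]
  have fi: "f \<in> isometries" using iso f(1) .
  have xa: "x \<in> axis_of f" and ya: "y \<in> axis_of f" using x y by (auto simp: passes_at_def)
  define \<gamma> where "\<gamma> = geodesic x (forward_tangent f x)"
  define L where "L = translation_length c"
  have L: "L > 0" using e translation_length_pos by (simp add: L_def)
  note ax = axis_geodesic[OF fr xa, folded \<gamma>_def L_def]
  note shift = generated_singleton_shift[OF fr fi xa, folded \<gamma>_def L_def]
  have \<gamma>0: "\<gamma> 0 = x" by (simp add: \<gamma>_def)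
  have gen: "generated {f} \<subseteq> \<Gamma>"
    using f(1) by (intro generated_minimal) (auto simp: Gb_one Gb_mult Gb_inv)
  obtain s0 where s0: "y = \<gamma> s0" using ax(4)[OF ya] by blast
  have same_orbit: "\<exists>n::int. s = s' + n * L" if orb: "orbit \<Gamma> (\<gamma> s) = orbit \<Gamma> (\<gamma> s')" for s s'
  proof -
    obtain D where D: "D \<in> \<Gamma>" "\<gamma> s = D *v \<gamma> s'"
      using orbit_eqD[OF orb] .
    have "D \<in> generated {f}"
      using f(2) D ax(1)[of s'] ax(1)[of s] unfolding simple_closed_geodesic_def by metis
    then obtain n :: int where "D *v \<gamma> s' = \<gamma> (s' + n * L)" using shift(1) by blast
    then show ?thesis using D(2) ax(5) by metis
  qed
  \<comment> \<open>The shift by \<open>n\<close> periods moves \<open>y\<close> into the segment from \<open>x\<close> to \<open>f x\<close>.\<close>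
  define n where "n = - \<lfloor>s0 / L\<rfloor>"
  define s1 where "s1 = s0 + n * L"
  obtain F where F: "F \<in> generated {f}" "\<And>s. F *v \<gamma> s = \<gamma> (s + n * L)" "F *v Xzero f = Xzero f"
    using shift(2)[of n] by blast
  have F\<Gamma>: "F \<in> \<Gamma>" using F(1) gen by blast
  have Fy: "F *v y = \<gamma> s1" by (simp add: s0 F(2) s1_def)
  have "s1 = L * frac (s0 / L)"
    using L by (simp add: s1_def n_def frac_def algebra_simps)
  moreover have "s1 \<noteq> 0"
  proof
    assume "s1 = 0"
    then have "orbit \<Gamma> x = orbit \<Gamma> (F *v y)" by (simp add: Fy \<gamma>0)
    then show False using orbit_image[OF Gb_isometries[OF G] F\<Gamma>] twice(2) by simp
  qed
  ultimately have s1: "0 < s1" "s1 < L"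
    using L frac_lt_1[of "s0 / L"] frac_ge_0[of "s0 / L"]
    by (auto simp: zero_less_mult_iff less_le)
  have off: "\<gamma> s \<in> off_walls walls" if s: "0 < s" "s < L" "s \<noteq> s1" for s
  proof (rule ccontr)
    assume "\<gamma> s \<notin> off_walls walls"
    moreover have "\<gamma> s \<in> H2" using ax(1) by (auto simp: axis_of_def)
    ultimately have "\<gamma> s \<in> dividing_lifts b g"
      unfolding complement_dividing_lifts[symmetric] by blast
    then obtain k D w where k: "k \<in> {1..b-2}" "D \<in> \<Gamma>" "w \<in> axis_of (hcurve g k)" "\<gamma> s = D *v w"
      unfolding dividing_lifts_def by blast
    have "orbit \<Gamma> (\<gamma> s) = orbit \<Gamma> w"
      unfolding k(4) by (rule orbit_image[OF Gb_isometries[OF G] k(2)])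
    then have *: "orbit \<Gamma> (\<gamma> s) \<in> closed_geodesic \<Gamma> f \<inter> closed_geodesic \<Gamma> (hcurve g k)"
      unfolding closed_geodesic_def using ax(1) k(3) by blast
    have "k = l" using disjoint[OF k(1)] * by blast
    then have "orbit \<Gamma> (\<gamma> s) = orbit \<Gamma> (\<gamma> 0) \<or> orbit \<Gamma> (\<gamma> s) = orbit \<Gamma> (\<gamma> s0)"
      using * twice(1) by (simp add: \<gamma>0 s0)
    then obtain j :: int where "s = 0 + j * L \<or> s = s0 + j * L"
      using same_orbit by blast
    then obtain i :: int where "s = i * L \<or> s - s1 = i * L"
      by (metis (no_types) add.commute add_0 add_diff_cancel_left left_diff_distrib of_int_diff s1_def)
    then show False
    proof
      assume "s = i * L"
      then have "0 < real_of_int i" "real_of_int i < 1" using s L by (auto simp: zero_less_mult_iff)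
      then show False by simp
    next
      assume i: "s - s1 = i * L"
      have "\<bar>s - s1\<bar> < L" using s s1 by linarith
      then have "\<bar>real_of_int i\<bar> < 1" using L unfolding i abs_mult by simp
      then have "i = 0" by linarith
      then show False using i s(3) by simp
    qed
  qed
  have cont: "continuous_on S \<gamma>" for S unfolding \<gamma>_def by (rule continuous_geodesic)
  have minus: "geodesic w (- v) s = geodesic w v (- s)" for w v s by (simp add: geodesic_def)
  have ml: "l \<in> {1..b-1}" "l + 1 \<in> {1..b-1}" using l b by auto
  have inE: "E *v w \<in> (\<lambda>x. (E ** D) *v x) ` Q" if "w \<in> (\<lambda>x. D *v x) ` Q" for E D w and Q :: "(real^3) set"
    using that by (auto simp: matrix_vector_mul_assoc[symmetric])
  let ?t = "forward_tangent f x" and ?t' = "forward_tangent f y"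
  note tx = axis_tangent[OF fr xa] and ty = axis_tangent[OF fr ya]
  have \<gamma>y: "F *v geodesic y ?t' s = \<gamma> (s1 + s)" for s
    using ax(3)[of s0 s] F(2)[of "s0 + s"] by (simp add: s0 s1_def algebra_simps)
  \<comment> \<open>The two regions at \<open>x\<close> and at \<open>y\<close>; the incoming side is treated as a geodesic that leaves backwards.\<close>
  have x_right: "\<forall>\<^sub>F s in at_right 0. \<gamma> s \<in> (\<lambda>x. C *v x) ` R (l+1)"
    unfolding \<gamma>_def using x tx by (intro crossing_germ[OF l _ C]) (auto simp: passes_at_def)
  have x_left: "\<forall>\<^sub>F s in at_right 0. \<gamma> (- s) \<in> (\<lambda>x. C *v x) ` R l"
    unfolding \<gamma>_def minus[symmetric] using x tx
    by (intro crossing_germ[OF l _ C])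
      (auto simp: passes_at_def minus eventually_at_left_to_right)
  have y_right: "\<forall>\<^sub>F s in at_right 0. geodesic y ?t' s \<in> (\<lambda>x. C' *v x) ` R l"
    using y ty by (intro crossing_germ[OF l _ C']) (auto simp: passes_at_def)
  have y_left: "\<forall>\<^sub>F s in at_right 0. geodesic y (- ?t') s \<in> (\<lambda>x. C' *v x) ` R (l+1)"
    using y ty by (intro crossing_germ[OF l _ C'])
      (auto simp: passes_at_def minus eventually_at_left_to_right)
  let ?E = "F ** C'"
  have E: "?E \<in> \<Gamma>" using F\<Gamma> C'(1) by (rule Gb_mult)
  have near: "\<exists>s. 0 < s \<and> s < d \<and> P s" if P: "\<forall>\<^sub>F s in at_right 0. P s" and d: "d > 0" for P and d :: real
  proof -
    have "\<forall>\<^sub>F s in at_right 0. s \<in> {0<..<d} \<and> P s"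
      by (intro eventually_conj P eventually_at_right_real d)
    then show ?thesis by (auto dest!: eventually_happens)
  qed
  have "(\<lambda>x. C *v x) ` R (l+1) = (\<lambda>x. ?E *v x) ` R (l+1)"
  proof -
    obtain s where s: "0 < s" "s < s1" "\<gamma> s \<in> (\<lambda>x. C *v x) ` R (l+1)"
      using near[OF x_right s1(1)] by blast
    obtain s' where s': "0 < s'" "s' < s1" "geodesic y (- ?t') s' \<in> (\<lambda>x. C' *v x) ` R (l+1)"
      using near[OF y_left s1(1)] by blast
    have "\<gamma> (s1 - s') \<in> (\<lambda>x. ?E *v x) ` R (l+1)"
      using inE[OF s'(3), of F] by (simp add: minus \<gamma>y)
    with s s' s1 off show ?thesis
      by (intro translates_eq_along_path[OF C(1) E ml(2) ml(2) cont[of "{0<..<s1}"], of s "s1 - s'"]) auto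
  qed
  then have q: "matrix_inv ?E ** C \<in> pants_group b g (l+1)"
    by (rule stabilizer_quotient[OF C(1) E ml(2)])
  have fC: "f ** C \<in> \<Gamma>" using f(1) C(1) by (rule Gb_mult)
  have "(\<lambda>x. (f ** C) *v x) ` R l = (\<lambda>x. ?E *v x) ` R l"
  proof -
    have d: "L - s1 > 0" using s1 by simp
    obtain s where s: "0 < s" "s < L - s1" "\<gamma> (- s) \<in> (\<lambda>x. C *v x) ` R l"
      using near[OF x_left d] by blast
    obtain s' where s': "0 < s'" "s' < L - s1" "geodesic y ?t' s' \<in> (\<lambda>x. C' *v x) ` R l"
      using near[OF y_right d] by blast
    have "\<gamma> (L - s) \<in> (\<lambda>x. (f ** C) *v x) ` R l"
      using inE[OF s(3), of f] by (simp add: ax(2))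
    moreover have "\<gamma> (s1 + s') \<in> (\<lambda>x. ?E *v x) ` R l"
      using inE[OF s'(3), of F] by (simp add: \<gamma>y)
    ultimately show ?thesis using s s' s1 off
      by (intro translates_eq_along_path[OF fC E ml(1) ml(1) cont[of "{s1<..<L}"], of "L - s" "s1 + s'"]) auto
  qed
  then have p: "matrix_inv ?E ** (f ** C) \<in> pants_group b g l"
    by (rule stabilizer_quotient[OF fC E ml(1)])
  have cancel: "?E ** (matrix_inv ?E ** X) = X" for X :: "real^3^3"
    using iso[OF E] by (simp add: matrix_mul_assoc)
  show thesis
    by (rule that[OF F\<Gamma> F(3) p q]) (simp_all only: cancel)
qed

lemma pants_group_subset: "m \<in> {1..b-1} \<Longrightarrow> pants_group b g m \<subseteq> \<Gamma>"
  using pants_group_stabilizer by blast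

text \<open>Put \<open>E = F C'\<close>. Modulo vectors orthogonal to \<open>X\<^sup>0\<^sub>f\<close>, the cocycle identity applied to \<open>f C = E p\<close> and
  \<open>C = E q\<close> gives \<open>w f = E (w p - w q)\<close>. If \<open>k \<noteq> l\<close>, then \<open>w\<close> is on both pants groups the coboundary
  of the same vector, which is \<open>0\<close> or \<open>Y\<^sub>k\<close>, and the difference cancels. If \<open>k = l\<close>, then \<open>w p = 0\<close> and
  \<open>E (w q) = E Y\<^sub>l - C Y\<^sub>l\<close>.\<close>

lemma margulis_affine_twist:
  assumes l: "l \<in> {1..b-2}" and k: "k \<in> {1..b-2}"
    and w: "affine_twist b g k w"
    and f: "f \<in> \<Gamma>" "f *v Xzero f = Xzero f"
    and F: "F \<in> \<Gamma>" "F *v Xzero f = Xzero f" and C: "C \<in> \<Gamma>" "C' \<in> \<Gamma>"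
    and p: "p \<in> pants_group b g l" and q: "q \<in> pants_group b g (l+1)"
    and eq: "f ** C = (F ** C') ** p" "C = (F ** C') ** q"
  shows "margulis w f = (if k = l then B (C *v Xzero (hcurve g l)) (Xzero f)
    - B (C' *v Xzero (hcurve g l)) (Xzero f) else 0)"
proof -
  let ?E = "F ** C'" and ?z = "Xzero f" and ?Y = "Xzero (hcurve g k)"
  have E: "?E \<in> \<Gamma>" using F(1) C(2) by (rule Gb_mult)
  have ml: "l \<in> {1..b-1}" "l + 1 \<in> {1..b-1}" using l b by auto
  have pq: "p \<in> \<Gamma>" "q \<in> \<Gamma>" using p q pants_group_subset ml by blast+
  have coc: "w (A ** A') = A *v w A' + w A" if "A \<in> \<Gamma>" "A' \<in> \<Gamma>" for A A'
    using w that unfolding affine_twist_def cocycle_def by blast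
  have zero: "w A = 0" if "A \<in> pants_group b g m" "1 \<le> m" "m \<le> k" for A m
    using w that unfolding affine_twist_def by auto
  have cob: "w A = ?Y - A *v ?Y" if "A \<in> pants_group b g m" "k + 1 \<le> m" "m \<le> b - 1" for A m
    using w that unfolding affine_twist_def coboundary_def by auto
  have fix_z: "B (A *v v) ?z = B v ?z" if "A \<in> \<Gamma>" "A *v ?z = ?z" for A v
    using B_isometry[OF iso[OF that(1)], of v ?z] that(2) by simp
  have "w f = w (f ** C) - f *v w C"
    using coc[OF f(1) C(1)] by simp
  then have "margulis w f = B (w (f ** C)) ?z - B (w C) ?z"
    using fix_z[OF f] by (simp add: margulis_def)
  also have "\<dots> = B (?E *v w p) ?z - B (?E *v w q) ?z"
    unfolding eq(1) using coc[OF E pq(1)] coc[OF E pq(2)] eq(2) by simp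
  finally have key: "margulis w f = B (?E *v w p) ?z - B (?E *v w q) ?z" .
  \<comment> \<open>The cocycle \<open>w\<close> vanishes on the first \<open>k\<close> pants groups and is the coboundary of \<open>Y\<^sub>k\<close> on the later ones.\<close>
  consider "k = l" | "l < k" | "k < l" by linarith
  then show ?thesis
  proof cases
    case 1
    have "w p = 0" using zero[OF p] l 1 by simp
    moreover have "w q = ?Y - q *v ?Y" using cob[OF q] l ml 1 by simp
    ultimately have "margulis w f = B (?E *v (q *v ?Y)) ?z - B (?E *v ?Y) ?z"
      unfolding key by (simp add: matrix_vector_mult_diff_distrib)
    also have "?E *v (q *v ?Y) = C *v ?Y"
      by (simp only: matrix_vector_mul_assoc eq(2)[symmetric])
    also have "B (?E *v ?Y) ?z = B (C' *v ?Y) ?z"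
      using fix_z[OF F] by (simp flip: matrix_vector_mul_assoc)
    finally show ?thesis using 1 by simp
  next
    case 2
    have "w p = 0" "w q = 0" using zero[OF p] zero[OF q] l 2 by simp_all
    then show ?thesis using 2 key by simp
  next
    case 3
    have "w p = ?Y - p *v ?Y" "w q = ?Y - q *v ?Y"
      using cob[OF p] cob[OF q] l ml 3 by simp_all
    then have "margulis w f = B (?E *v (q *v ?Y)) ?z - B (?E *v (p *v ?Y)) ?z"
      unfolding key by (simp add: matrix_vector_mult_diff_distrib)
    also have "?E *v (q *v ?Y) = C *v ?Y"
      by (simp only: matrix_vector_mul_assoc eq(2)[symmetric])
    also have "?E *v (p *v ?Y) = f *v (C *v ?Y)"
      by (simp only: matrix_vector_mul_assoc eq(1)[symmetric])
    also have "B (f *v (C *v ?Y)) ?z = B (C *v ?Y) ?z" by (rule fix_z[OF f])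
    finally show ?thesis using 3 by simp
  qed
qed

end

section \<open>Exponentials and eigenvalues of two-by-two matrices\<close>

text \<open>The inverse of \<open>psi\<close> on traceless matrices.\<close>

definition sl2_of :: "real^3 \<Rightarrow> real^2^2" where
  "sl2_of v = vector [vector [v$1, v$2 - v$3], vector [v$2 + v$3, - v$1]]"

lemmas mat2_simps = vec_eq_iff forall_2 matrix_matrix_mult_def sum_2 mat_def sl2_of_def trace_def det_2

lemma psi_sl2_of [simp]: "psi (sl2_of v) = v"
  by (simp add: psi_def sl2_of_def vec_eq_iff forall_3)

lemma sl2_of_in_sl2 [simp]: "sl2_of v \<in> sl2"
  by (simp add: sl2_def mat2_simps)

lemma sl2_of_psi: "N \<in> sl2 \<Longrightarrow> sl2_of (psi N) = N"
  by (auto simp: sl2_def psi_def mat2_simps field_simps)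

lemma sl2_of_linear:
  "sl2_of (v + w) = sl2_of v + sl2_of w" "sl2_of (a *\<^sub>R v) = a *\<^sub>R sl2_of v" "sl2_of 0 = 0"
  by (simp_all add: mat2_simps algebra_simps)

lemma inv_into_psi [simp]: "inv_into sl2 psi v = sl2_of v"
proof -
  have "inj_on psi sl2" by (metis inj_onI sl2_of_psi)
  from inv_into_f_f[OF this sl2_of_in_sl2] show ?thesis by simp
qed

lemma sl2_of_anticommutator:
  "sl2_of v ** sl2_of w + sl2_of w ** sl2_of v = (2 * B v w) *\<^sub>R mat 1"
  by (simp add: mat2_simps B_def algebra_simps)

lemma sl2_of_square: "sl2_of v ** sl2_of v = B v v *\<^sub>R mat 1"
  by (simp add: mat2_simps B_def algebra_simps)

lemma trace_sl2_of_mult: "trace (sl2_of v ** sl2_of w) = 2 * B v w"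
  by (simp add: mat2_simps B_def algebra_simps)

lemma trace_sl2_of_triple:
  "trace (sl2_of x ** (sl2_of y ** sl2_of z)) = 2 * det (vector [x, y, z] :: real^3^3)"
  by (simp add: mat2_simps det_3 algebra_simps)

lemma det_id_plus_sl2_of: "det (a *\<^sub>R mat 1 + b *\<^sub>R sl2_of w) = a\<^sup>2 - b\<^sup>2 * B w w"
  by (simp add: mat2_simps B_def power2_eq_square algebra_simps)

text \<open>These are \<open>cosh \<surd>q\<close> and \<open>sinh \<surd>q / \<surd>q\<close>, given by their power series in \<open>q\<close> because the argument
  \<open>B w w\<close> can have either sign. The series are indexed like the exponential series, whose even and odd
  parts they are.\<close>

definition cosh_sqrt :: "real \<Rightarrow> real" where
  "cosh_sqrt q = (\<Sum>n. if even n then q ^ (n div 2) / fact n else 0)"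

definition sinhc_sqrt :: "real \<Rightarrow> real" where
  "sinhc_sqrt q = (\<Sum>n. if odd n then q ^ (n div 2) / fact n else 0)"

lemma summable_half_powers:
  "summable (\<lambda>n. \<bar>q::real\<bar> ^ (n div 2) / fact n)"
proof (rule summable_comparison_test)
  have le: "\<bar>q\<bar> ^ (n div 2) \<le> (1 + \<bar>q\<bar>) ^ n" for n
  proof -
    have "\<bar>q\<bar> ^ (n div 2) \<le> (1 + \<bar>q\<bar>) ^ (n div 2)" by (intro power_mono) auto
    also have "\<dots> \<le> (1 + \<bar>q\<bar>) ^ n" by (intro power_increasing) auto
    finally show ?thesis .
  qed
  show "\<exists>N. \<forall>n\<ge>N. norm (\<bar>q\<bar> ^ (n div 2) / fact n) \<le> (1 + \<bar>q\<bar>) ^ n /\<^sub>R fact n"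
    using le by (auto simp: divide_inverse mult.commute intro!: mult_left_mono)
  show "summable (\<lambda>n. (1 + \<bar>q\<bar>) ^ n /\<^sub>R fact n)" by (rule summable_exp_generic)
qed

lemma half_power_series:
  "(\<lambda>n. if even n then q ^ (n div 2) / fact n else 0) sums cosh_sqrt q"
  "(\<lambda>n. if odd n then q ^ (n div 2) / fact n else 0) sums sinhc_sqrt q"
proof -
  have "summable (\<lambda>n. if P n then q ^ (n div 2) / fact n else 0)" for P
    by (rule summable_comparison_test[OF _ summable_half_powers[of q]]) (auto simp: power_abs)
  from this[of even] this[of odd]
  show "(\<lambda>n. if even n then q ^ (n div 2) / fact n else 0) sums cosh_sqrt q"
    "(\<lambda>n. if odd n then q ^ (n div 2) / fact n else 0) sums sinhc_sqrt q"
    unfolding cosh_sqrt_def sinhc_sqrt_def by (simp_all add: summable_sums)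
qed

text \<open>With a complex square root \<open>z\<close> of \<open>q\<close> this is \<open>cosh\<^sup>2 z - sinh\<^sup>2 z = 1\<close>, for both signs of \<open>q\<close>
  at once.\<close>

lemma cosh_sqrt_sinhc_sqrt: "(cosh_sqrt q)\<^sup>2 - (sinhc_sqrt q)\<^sup>2 * q = 1"
proof -
  define z where "z = csqrt (of_real q)"
  have z2: "z\<^sup>2 = of_real q" by (simp add: z_def)
  have pow: "z ^ n = (if even n then of_real (q ^ (n div 2)) else z * of_real (q ^ (n div 2)))" for n
    by (auto simp: power_mult z2 elim!: evenE oddE)
  have "(\<lambda>n. of_real (if even n then q ^ (n div 2) / fact n else 0)) sums (of_real (cosh_sqrt q) :: complex)"
    using half_power_series(1) by (simp only: sums_of_real_iff)
  also have "(\<lambda>n. of_real (if even n then q ^ (n div 2) / fact n else 0)) = (\<lambda>n. if even n then z ^ n /\<^sub>R fact n else 0)"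
    by (auto simp: fun_eq_iff pow scaleR_conv_of_real field_simps)
  finally have C: "cosh z = of_real (cosh_sqrt q)"
    using cosh_converges sums_unique2 by blast
  have "(\<lambda>n. z * of_real (if odd n then q ^ (n div 2) / fact n else 0)) sums (z * of_real (sinhc_sqrt q) :: complex)"
    using half_power_series(2) by (intro sums_mult) (simp only: sums_of_real_iff)
  also have "(\<lambda>n. z * of_real (if odd n then q ^ (n div 2) / fact n else 0)) = (\<lambda>n. if even n then 0 else z ^ n /\<^sub>R fact n)"
    by (auto simp: fun_eq_iff pow scaleR_conv_of_real field_simps)
  finally have S: "sinh z = z * of_real (sinhc_sqrt q)"
    using sinh_converges sums_unique2 by blast
  have "of_real ((cosh_sqrt q)\<^sup>2 - (sinhc_sqrt q)\<^sup>2 * q) = (cosh z)\<^sup>2 - (sinh z)\<^sup>2"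
    by (simp add: C S power_mult_distrib z2)
  also have "\<dots> = (1 :: complex)" by (simp add: cosh_square_eq)
  finally show ?thesis by (simp only: of_real_eq_1_iff)
qed

text \<open>Beyond the leading term \<open>1\<close> every term is at most \<open>\<bar>q\<bar>\<close> times the corresponding term of the series
  of \<open>exp 1\<close>.\<close>

lemma half_power_series_minus_one:
  assumes "\<bar>q\<bar> \<le> 1"
  shows "\<bar>cosh_sqrt q - 1\<bar> \<le> exp 1 * \<bar>q\<bar>" "\<bar>sinhc_sqrt q - 1\<bar> \<le> exp 1 * \<bar>q\<bar>"
proof -
  have g: "(\<lambda>n. \<bar>q\<bar> * (1 / fact n)) sums (\<bar>q\<bar> * exp 1)"
    using exp_converges[of "1::real"] by (intro sums_mult) (simp add: divide_inverse)
  have bound: "\<bar>L - 1\<bar> \<le> exp 1 * \<bar>q\<bar>"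
    if L: "(\<lambda>n. if P n then q ^ (n div 2) / fact n else 0) sums L" and P: "P k" "\<not> P (1 - k)" "k \<le> 1" for L P k
  proof -
    have "(\<lambda>n. if n = k then 1 else 0 :: real) sums 1" by (rule sums_single)
    from sums_diff[OF L this] have s: "(\<lambda>n. (if P n then q ^ (n div 2) / fact n else 0) - (if n = k then 1 else 0)) sums (L - 1)" .
    have "norm ((if P n then q ^ (n div 2) / fact n else 0) - (if n = k then 1 else 0)) \<le> \<bar>q\<bar> * (1 / fact n)" for n
    proof (cases "n \<le> 1")
      case True
      then have "n = 0 \<or> n = 1" "k = 0 \<or> k = 1" using P(3) by auto
      then show ?thesis using P(1,2) by (elim disjE) auto
    next
      case False
      then have "\<bar>q\<bar> ^ (n div 2) \<le> \<bar>q\<bar> ^ 1" using assms by (intro power_decreasing) auto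
      then show ?thesis using False P(3) by (auto simp: power_abs divide_right_mono)
    qed
    then have "norm (\<Sum>n. (if P n then q ^ (n div 2) / fact n else 0) - (if n = k then 1 else 0)) \<le> (\<Sum>n. \<bar>q\<bar> * (1 / fact n))"
      using g by (intro norm_suminf_le) (auto simp: sums_iff)
    then show ?thesis using s g by (simp add: sums_iff mult.commute)
  qed
  show "\<bar>cosh_sqrt q - 1\<bar> \<le> exp 1 * \<bar>q\<bar>" by (rule bound[OF half_power_series(1), of 0]) auto
  show "\<bar>sinhc_sqrt q - 1\<bar> \<le> exp 1 * \<bar>q\<bar>" by (rule bound[OF half_power_series(2), of 1]) auto
qed

lemma sl2_of_powers:
  "((\<lambda>N. sl2_of w ** N) ^^ n) (mat 1) =
    (if even n then B w w ^ (n div 2) *\<^sub>R mat 1 else B w w ^ (n div 2) *\<^sub>R sl2_of w)"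
proof (induction n)
  case (Suc n)
  have "sl2_of w ** (a *\<^sub>R mat 1) = a *\<^sub>R sl2_of w" "sl2_of w ** (a *\<^sub>R sl2_of w) = (a * B w w) *\<^sub>R mat 1" for a
    by (simp_all add: mat2_simps B_def algebra_simps)
  then show ?case using Suc by auto
qed auto

text \<open>The square of a traceless matrix is the scalar \<open>B w w\<close>, so even powers are scalars and odd powers are
  multiples of the matrix.\<close>

lemma matrix_exp_sl2_of:
  "matrix_exp (sl2_of w) = cosh_sqrt (B w w) *\<^sub>R mat 1 + sinhc_sqrt (B w w) *\<^sub>R sl2_of w"
proof -
  let ?q = "B w w"
  have "(\<lambda>n. (if even n then ?q ^ (n div 2) / fact n else 0) *\<^sub>R mat 1
      + (if odd n then ?q ^ (n div 2) / fact n else 0) *\<^sub>R sl2_of w)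
    sums (cosh_sqrt ?q *\<^sub>R mat 1 + sinhc_sqrt ?q *\<^sub>R sl2_of w)"
    by (intro sums_add sums_scaleR_left half_power_series)
  also have "(\<lambda>n. (if even n then ?q ^ (n div 2) / fact n else 0) *\<^sub>R mat 1
      + (if odd n then ?q ^ (n div 2) / fact n else 0) *\<^sub>R sl2_of w)
    = (\<lambda>n. (1 / fact n) *\<^sub>R (((\<lambda>N. sl2_of w ** N) ^^ n) (mat 1)))"
    by (auto simp: fun_eq_iff sl2_of_powers)
  finally show ?thesis unfolding matrix_exp_def by (simp add: sums_iff)
qed

lemma det_matrix_exp_sl2_of: "det (matrix_exp (sl2_of w)) = 1"
  unfolding matrix_exp_sl2_of det_id_plus_sl2_of by (rule cosh_sqrt_sinhc_sqrt)

lemma DERIV_near_one_compose: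
  fixes q :: "real \<Rightarrow> real"
  assumes \<phi>: "\<And>x. \<bar>x\<bar> \<le> 1 \<Longrightarrow> \<bar>\<phi> x - 1\<bar> \<le> K * \<bar>x\<bar>"
    and q: "(q has_real_derivative 0) (at 0)" "q 0 = 0"
  shows "((\<lambda>s. \<phi> (q s)) has_real_derivative 0) (at 0)"
proof -
  have \<phi>0: "\<phi> 0 = 1" using \<phi>[of 0] by simp
  have lim: "((\<lambda>h. q h / h) \<longlongrightarrow> 0) (at 0)"
    using q by (simp add: DERIV_def)
  have "isCont q 0" using q(1) by (rule DERIV_isCont)
  then have "((\<lambda>h. \<bar>q h\<bar>) \<longlongrightarrow> 0) (at 0)"
    using q(2) by (simp add: isCont_def tendsto_rabs_zero)
  then have "\<forall>\<^sub>F h in at 0. \<bar>q h\<bar> < 1" by (rule order_tendstoD) simp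
  then have "\<forall>\<^sub>F h in at 0. norm ((\<phi> (q h) - 1) / h) \<le> K * \<bar>q h / h\<bar>"
  proof eventually_elim
    case (elim h)
    then show ?case using \<phi>[of "q h"] by (simp add: divide_right_mono)
  qed
  moreover have "((\<lambda>h. K * \<bar>q h / h\<bar>) \<longlongrightarrow> 0) (at 0)"
    using tendsto_mult[OF tendsto_const tendsto_rabs_zero[OF lim], of K] by simp
  ultimately have "((\<lambda>h. (\<phi> (q h) - 1) / h) \<longlongrightarrow> 0) (at 0)"
    by (rule Lim_null_comparison)
  then show ?thesis by (simp add: DERIV_def q(2) \<phi>0)
qed

lemma DERIV_quadratic_remainder:
  fixes \<rho> :: "real \<Rightarrow> real"
  assumes "\<forall>\<^sub>F s in nhds 0. \<bar>\<rho> s\<bar> \<le> K * s\<^sup>2"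
  shows "(\<rho> has_real_derivative 0) (at 0)" "\<rho> 0 = 0"
proof -
  show 0: "\<rho> 0 = 0" using eventually_nhds_x_imp_x[OF assms] by simp
  have "\<forall>\<^sub>F s in at 0. \<bar>\<rho> s\<bar> \<le> K * s\<^sup>2"
    using assms unfolding eventually_nhds_conv_at by simp
  then have "\<forall>\<^sub>F s in at 0. norm (\<rho> s / s) \<le> K * \<bar>s\<bar>"
    using eventually_neq_at_within[of 0 0 UNIV]
  proof eventually_elim
    case (elim s)
    then show ?case by (simp add: divide_le_eq power2_eq_square mult.assoc)
  qed
  moreover have "((\<lambda>s. K * \<bar>s\<bar>) \<longlongrightarrow> 0) (at (0::real))"
    by (auto intro!: tendsto_eq_intros)
  ultimately have "((\<lambda>s. \<rho> s / s) \<longlongrightarrow> 0) (at 0)" by (rule Lim_null_comparison)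
  then show "(\<rho> has_real_derivative 0) (at 0)" by (simp add: DERIV_def 0)
qed

text \<open>As \<open>W\<close> vanishes at \<open>0\<close>, the argument \<open>B (W s) (W s)\<close> has derivative \<open>0\<close> there. To first order the two
  coefficients in the exponential are therefore \<open>1\<close>.\<close>

lemma trace_matrix_exp_derivative:
  fixes M :: "real^2^2" and W :: "real \<Rightarrow> real^3"
  assumes W: "\<And>i. ((\<lambda>s. W s $ i) has_real_derivative v $ i) (at 0)" "W 0 = 0"
  shows "((\<lambda>s. trace (M ** matrix_exp (sl2_of (W s)))) has_real_derivative trace (M ** sl2_of v)) (at 0)"
proof -
  have q: "((\<lambda>s. B (W s) (W s)) has_real_derivative 0) (at 0)" "B (W 0) (W 0) = 0"
    unfolding B_def by (auto intro!: derivative_eq_intros W(1) simp: W(2))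
  have C: "((\<lambda>s. cosh_sqrt (B (W s) (W s))) has_real_derivative 0) (at 0)"
    by (rule DERIV_near_one_compose[OF half_power_series_minus_one(1) q])
  have S: "((\<lambda>s. sinhc_sqrt (B (W s) (W s))) has_real_derivative 0) (at 0)"
    by (rule DERIV_near_one_compose[OF half_power_series_minus_one(2) q])
  have S0: "sinhc_sqrt 0 = 1" using half_power_series_minus_one(2)[of 0] by simp
  have split: "trace (M ** (a *\<^sub>R mat 1 + c *\<^sub>R N)) = a * trace M + c * trace (M ** N)" for a c and N :: "real^2^2"
    by (simp add: mat2_simps algebra_simps)
  have "((\<lambda>s. trace (M ** sl2_of (W s))) has_real_derivative trace (M ** sl2_of v)) (at 0)"
    unfolding mat2_simps by (simp, auto intro!: derivative_eq_intros W(1))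
  from DERIV_add[OF DERIV_cmult_right[OF C] DERIV_mult[OF S this]]
  show ?thesis
    unfolding matrix_exp_sl2_of split by (simp add: W(2) q(2) S0)
qed

lemma is_eigenvalue_2:
  fixes N :: "real^2^2"
  assumes "det N = 1"
  shows "is_eigenvalue N \<mu> \<longleftrightarrow> \<mu>\<^sup>2 - trace N * \<mu> + 1 = 0"
proof -
  have "mat \<mu> *v v = \<mu> *\<^sub>R v" for v :: "real^2"
    by (simp add: vec_eq_iff forall_2 matrix_vector_mult_def sum_2 mat_def)
  then have "is_eigenvalue N \<mu> \<longleftrightarrow> (\<exists>v. v \<noteq> 0 \<and> (N - mat \<mu>) *v v = 0)"
    unfolding is_eigenvalue_def by (simp add: matrix_vector_mult_diff_rdistrib)
  also have "\<dots> \<longleftrightarrow> \<not> invertible (N - mat \<mu>)"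
    unfolding invertible_left_inverse matrix_left_invertible_ker by blast
  also have "\<dots> \<longleftrightarrow> det (N - mat \<mu>) = 0" by (simp add: invertible_det_nz)
  also have "det (N - mat \<mu>) = \<mu>\<^sup>2 - trace N * \<mu> + det N"
    by (simp add: det_2 trace_def sum_2 mat_def power2_eq_square algebra_simps)
  finally show ?thesis using assms by simp
qed

text \<open>A positive \<open>\<mu>\<close> is an eigenvalue of \<open>N\<close> or of \<open>- N\<close> if and only if \<open>\<mu> + \<mu>\<^sup>-\<^sup>1 = \<bar>trace N\<bar>\<close>, that is,
  \<open>2 cosh (- ln \<mu>) = \<bar>trace N\<bar>\<close>.\<close>

lemma ell_trace:
  fixes N :: "real^2^2"
  assumes "det N = 1" "\<bar>trace N\<bar> > 2"
  shows "ell N = 2 * arcosh (\<bar>trace N\<bar> / 2)"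
proof -
  let ?x = "arcosh (\<bar>trace N\<bar> / 2)"
  have x: "?x > 0" "cosh ?x = \<bar>trace N\<bar> / 2" using assms by simp_all
  have eig: "is_eigenvalue N \<mu> \<or> is_eigenvalue N (- \<mu>) \<longleftrightarrow> \<mu>\<^sup>2 - \<bar>trace N\<bar> * \<mu> + 1 = 0" if "\<mu> > 0" for \<mu>
  proof -
    have "\<mu>\<^sup>2 + t * \<mu> + 1 \<noteq> 0" if "t \<ge> 0" for t
      using \<open>\<mu> > 0\<close> that by (smt (verit) mult_nonneg_nonneg zero_le_power2)
    then show ?thesis
      unfolding is_eigenvalue_2[OF assms(1)] by (cases "trace N \<ge> 0") (simp_all, smt (verit) minus_mult_left)
  qed
  have "(THE \<mu>. 0 < \<mu> \<and> \<mu> < 1 \<and> (is_eigenvalue N \<mu> \<or> is_eigenvalue N (- \<mu>))) = exp (- ?x)"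
  proof (rule the_equality)
    have "(exp (- ?x))\<^sup>2 - \<bar>trace N\<bar> * exp (- ?x) + 1 = 0"
    proof -
      have "\<bar>trace N\<bar> = exp ?x + exp (- ?x)" using x(2) by (simp add: cosh_field_def)
      moreover have "exp ?x * exp (- ?x) = 1" by (simp add: exp_minus)
      moreover have "t = E + F \<Longrightarrow> E * F = 1 \<Longrightarrow> F\<^sup>2 - t * F + 1 = 0" for t E F :: real
        by (simp add: power2_eq_square algebra_simps)
      ultimately show ?thesis by blast
    qed
    then show "0 < exp (- ?x) \<and> exp (- ?x) < 1 \<and> (is_eigenvalue N (exp (- ?x)) \<or> is_eigenvalue N (- exp (- ?x)))"
      using x eig[of "exp (- ?x)"] by simp
    fix \<mu> assume \<mu>: "0 < \<mu> \<and> \<mu> < 1 \<and> (is_eigenvalue N \<mu> \<or> is_eigenvalue N (- \<mu>))"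
    then have "\<mu>\<^sup>2 - \<bar>trace N\<bar> * \<mu> + 1 = 0" using eig by blast
    then have "\<bar>trace N\<bar> = \<mu> + 1 / \<mu>" using \<mu> by (simp add: field_simps power2_eq_square)
    also have "\<dots> = 2 * cosh (- ln \<mu>)" using \<mu> by (simp add: cosh_ln_real field_simps)
    finally have "?x = arcosh (cosh (- ln \<mu>))" by simp
    also have "\<dots> = - ln \<mu>" using \<mu> by (intro arcosh_cosh_real) simp
    finally show "\<mu> = exp (- ?x)" using \<mu> by simp
  qed
  then show ?thesis by (simp add: ell_def)
qed

section \<open>The derivative of the length function\<close>

text \<open>Let \<open>N\<close>, \<open>P\<close>, \<open>Z\<close> be the matrices of \<open>m\<close>, \<open>p\<close>, \<open>z\<close>. As \<open>A\<close> fixes \<open>z\<close>, the lift commutes with \<open>Z\<close>,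
  and \<open>Z\<^sup>2 = 1\<close>; so it is \<open>a + d Z\<close>. For the sign of \<open>a d\<close>, the relation \<open>M P = c\<^sup>-\<^sup>1 P M\<close> and
  \<open>P Z = - Z P\<close> make \<open>Z P\<close> a multiple of \<open>P\<close> by a factor with the sign of \<open>a d\<close>. Taking the trace of
  \<open>N Z P\<close> shows that this factor is \<open>- det (z, m, p) / B m p\<close>, which is positive: the orientation of
  \<open>X\<^sup>0\<close> matches the lift.\<close>

lemma lift_of_hyperbolic:
  assumes fr: "eigenframe A c m p z" and lift: "is_lift M A"
  obtains a d where "M = a *\<^sub>R mat 1 + d *\<^sub>R sl2_of z" "a\<^sup>2 - d\<^sup>2 = 1" "a * d > 0"
proof -
  note e = eigenframeD[OF fr]
  have det: "det M = 1" using lift by (simp add: is_lift_def)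
  then have "invertible M" by (simp add: invertible_det_nz)
  then have Minv: "M ** matrix_inv M = mat 1 \<and> matrix_inv M ** M = mat 1"
    unfolding matrix_inv_def invertible_def by (rule someI_ex)
  have inter: "M ** sl2_of v = sl2_of (A *v v) ** M" for v
  proof -
    have "trace (M ** sl2_of v ** matrix_inv M) = trace (matrix_inv M ** (M ** sl2_of v))"
      by (rule trace_mul_sym)
    also have "\<dots> = trace (sl2_of v)" using Minv by (simp add: matrix_mul_assoc)
    finally have "M ** sl2_of v ** matrix_inv M \<in> sl2" using sl2_of_in_sl2[of v] by (simp add: sl2_def)
    moreover have "psi (M ** sl2_of v ** matrix_inv M) = A *v v"
      using lift by (simp add: is_lift_def)
    ultimately have "M ** sl2_of v ** matrix_inv M = sl2_of (A *v v)" using sl2_of_psi by metis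
    then have "sl2_of (A *v v) ** M = M ** sl2_of v ** (matrix_inv M ** M)"
      by (simp add: matrix_mul_assoc)
    then show ?thesis using Minv by simp
  qed
  define a w where "a = trace M / 2" and "w = psi (M - a *\<^sub>R mat 1)"
  have "M - a *\<^sub>R mat 1 \<in> sl2" by (simp add: sl2_def a_def mat2_simps)
  then have "sl2_of w = M - a *\<^sub>R mat 1" unfolding w_def by (rule sl2_of_psi)
  then have Maw: "M = a *\<^sub>R mat 1 + sl2_of w" by simp
  have scalar: "(t *\<^sub>R X) ** Y = t *\<^sub>R (X ** Y)" "X ** (t *\<^sub>R Y) = t *\<^sub>R (X ** Y)"
    for t and X Y :: "real^2^2"
    by (simp_all add: mat2_simps algebra_simps)
  have distrib: "(X + Y) ** U = X ** U + Y ** U" "U ** (X + Y) = U ** X + U ** Y" for U X Y :: "real^2^2"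
    by (simp_all add: mat2_simps algebra_simps)
  have "sl2_of w ** sl2_of z = sl2_of z ** sl2_of w"
    using inter[of z] unfolding e(5) Maw
    by (simp add: distrib scalar)
  with sl2_of_anticommutator[of w z] have "2 *\<^sub>R (sl2_of w ** sl2_of z) = 2 *\<^sub>R (B w z *\<^sub>R mat 1)"
    by (simp only: scaleR_2 scaleR_scaleR)
  then have "sl2_of w ** sl2_of z = B w z *\<^sub>R mat 1"
    unfolding scaleR_cancel_left by simp
  then have "(sl2_of w ** sl2_of z) ** sl2_of z = B w z *\<^sub>R sl2_of z"
    by (simp add: scalar)
  moreover have "(sl2_of w ** sl2_of z) ** sl2_of z = sl2_of w"
    unfolding matrix_mul_assoc[symmetric] sl2_of_square e(8) by (simp add: scalar)
  ultimately have M: "M = a *\<^sub>R mat 1 + B w z *\<^sub>R sl2_of z" using Maw by simp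
  define d where "d = B w z"
  have ad: "a\<^sup>2 - d\<^sup>2 = 1" using det unfolding M d_def[symmetric] det_id_plus_sl2_of by (simp add: e)
  have c1: "1 / c > 1" using e by simp
  let ?P = "sl2_of p" and ?Z = "sl2_of z" and ?N = "sl2_of m"
  have anti: "?P ** ?Z = - (?Z ** ?P)"
    using sl2_of_anticommutator[of p z] e by (simp add: eq_neg_iff_add_eq_0)
  have "M ** ?P = (1 / c) *\<^sub>R (?P ** M)"
    using inter[of p] unfolding e(4) by (simp add: sl2_of_linear scalar divide_inverse)
  then have "a *\<^sub>R ?P + d *\<^sub>R (?Z ** ?P) = (1 / c) *\<^sub>R (a *\<^sub>R ?P + d *\<^sub>R (?P ** ?Z))"
    unfolding M d_def[symmetric] by (simp add: distrib scalar)
  then have ZP: "(d * (1 + 1 / c)) *\<^sub>R (?Z ** ?P) = (a * (1 / c - 1)) *\<^sub>R ?P"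
    unfolding anti by (simp add: algebra_simps)
  have "trace (?N ** ((d * (1 + 1 / c)) *\<^sub>R (?Z ** ?P))) = trace (?N ** ((a * (1 / c - 1)) *\<^sub>R ?P))"
    by (simp only: ZP)
  moreover have "trace (X ** (t *\<^sub>R Y)) = t * trace (X ** Y)" for t and X Y :: "real^2^2"
    unfolding scalar by (simp add: trace_def sum_2 algebra_simps)
  ultimately have "(d * (1 + 1 / c)) * (2 * det (vector [m, z, p] :: real^3^3)) = (a * (1 / c - 1)) * (2 * B m p)"
    by (simp only: trace_sl2_of_triple trace_sl2_of_mult)
  moreover have solve: "d * k * (2 * D') = a * j * (2 * \<beta>) \<Longrightarrow> D' = - D \<Longrightarrow> d * (k * D) = a * (j * (- \<beta>))"
    for k j D D' \<beta> by (simp add: algebra_simps)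
  moreover have "det (vector [m, z, p] :: real^3^3) = - det (vector [z, m, p] :: real^3^3)"
    by (simp add: det_3)
  ultimately have eq: "d * ((1 + 1 / c) * det (vector [z, m, p] :: real^3^3)) = a * ((1 / c - 1) * (- B m p))"
    using solve by blast
  have pos: "(1 + 1 / c) * det (vector [z, m, p] :: real^3^3) > 0" "(1 / c - 1) * (- B m p) > 0"
    using mult_pos_pos[of "1 + 1 / c", OF _ e(17)] mult_pos_pos[of "1 / c - 1" "- B m p"] c1 e(15)
    by linarith+
  have "a \<noteq> 0"
  proof
    assume "a = 0"
    then show False using ad zero_le_power2[of d] by simp
  qed
  have "a * (d * ((1 + 1 / c) * det (vector [z, m, p] :: real^3^3))) = a\<^sup>2 * ((1 / c - 1) * (- B m p))"
    unfolding eq by (simp add: power2_eq_square)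
  also have "\<dots> > 0" using \<open>a \<noteq> 0\<close> by (intro mult_pos_pos[OF _ pos(2)]) simp
  finally have "(a * d) * ((1 + 1 / c) * det (vector [z, m, p] :: real^3^3)) > 0" by (simp add: mult.assoc)
  then have "a * d > 0" using pos(1) by (rule zero_less_mult_pos2)
  with M ad show thesis unfolding d_def[symmetric] by (intro that)
qed

text \<open>Write the lift as \<open>a + d Z\<close>. The trace of the deformation starts at \<open>2 a\<close> with derivative
  \<open>2 d B (X\<^sup>0, u A)\<close>, and the derivative of \<open>2 arcosh\<close> at \<open>\<bar>a\<bar>\<close> is \<open>2 / \<bar>d\<bar>\<close>. The signs cancel because \<open>a d > 0\<close>.\<close>

lemma length_fun_derivative:
  assumes hyp: "hyperbolic A" and lift: "is_lift M A"
    and r: "\<forall>\<^sub>F s in nhds 0. r s \<in> sl2" "(\<lambda>s. norm (r s)) \<in> O[nhds 0](\<lambda>s. s\<^sup>2)"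
  shows "(length_fun u A M r has_real_derivative 2 * margulis u A) (at 0)"
proof -
  obtain c m p z where fr: "eigenframe A c m p z" by (rule hyperbolic_eigenframe[OF hyp])
  have z: "Xzero A = z" by (rule eigenframe_Xzero[OF fr])
  note e = eigenframeD[OF fr]
  obtain a d where M: "M = a *\<^sub>R mat 1 + d *\<^sub>R sl2_of z" and ad: "a\<^sup>2 - d\<^sup>2 = 1" "a * d > 0"
    by (rule lift_of_hyperbolic[OF fr lift])
  define W where "W s = s *\<^sub>R u A + psi (r s)" for s
  define T where "T s = trace (M ** matrix_exp (sl2_of (W s)))" for s
  obtain K where K: "\<forall>\<^sub>F s in nhds 0. norm (norm (r s)) \<le> K * norm (s\<^sup>2 :: real)"
    using landau_o.bigE[OF r(2)] .
  have entry: "\<bar>r s $ i $ j\<bar> \<le> norm (r s)" for s i j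
    using component_le_norm_cart[of "r s $ i" j] Finite_Cartesian_Product.norm_nth_le[of "r s" i] by linarith
  have "\<forall>\<^sub>F s in nhds 0. \<bar>psi (r s) $ i\<bar> \<le> K * s\<^sup>2" for i
    using K
  proof eventually_elim
    case (elim s)
    have "\<bar>psi (r s) $ i\<bar> \<le> norm (r s)"
      using entry[of s 1 1] entry[of s 1 2] entry[of s 2 1] exhaust_3[of i]
      by (auto simp: psi_def)
    then show ?case using elim by simp
  qed
  note rem = DERIV_quadratic_remainder[OF this]
  have W: "((\<lambda>s. W s $ i) has_real_derivative u A $ i) (at 0)" for i
    unfolding W_def by (auto intro!: derivative_eq_intros rem(1))
  have W0: "W 0 = 0" using rem(2) by (simp add: W_def vec_eq_iff)
  have T': "(T has_real_derivative trace (M ** sl2_of (u A))) (at 0)"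
    unfolding T_def by (rule trace_matrix_exp_derivative[OF W W0])
  have trM: "trace (M ** sl2_of v) = 2 * d * B z v" for v
    unfolding M by (simp add: mat2_simps B_def algebra_simps)
  have exp0: "matrix_exp (sl2_of 0) = mat 1"
    using half_power_series_minus_one(1)[of 0] unfolding matrix_exp_sl2_of by (simp add: sl2_of_linear)
  have T0: "T 0 = 2 * a"
    unfolding T_def W0 exp0 unfolding M by (simp add: mat2_simps)
  have a1: "\<bar>a\<bar> > 1"
  proof -
    have "d \<noteq> 0" using ad(2) by auto
    then have "d\<^sup>2 > 0" by simp
    then have "a\<^sup>2 > 1" using ad(1) by linarith
    then show ?thesis using abs_square_le_1[of a] by linarith
  qed
  have len: "\<forall>\<^sub>F s in nhds 0. length_fun u A M r s = 2 * arcosh (sgn a * T s / 2)"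
  proof -
    have "isCont (\<lambda>s. sgn a * T s) 0"
      using DERIV_isCont[OF T'] by (intro continuous_intros)
    then have "((\<lambda>s. sgn a * T s) \<longlongrightarrow> sgn a * T 0) (nhds 0)"
      by (simp only: isCont_def tendsto_at_iff_tendsto_nhds[of "\<lambda>s. sgn a * T s" 0])
    moreover have "sgn a * T 0 = 2 * \<bar>a\<bar>" by (simp add: T0 abs_sgn mult.commute)
    ultimately have "\<forall>\<^sub>F s in nhds 0. sgn a * T s > 2"
      using a1 by (intro order_tendstoD(1)) auto
    with r(1) show ?thesis
    proof eventually_elim
      case (elim s)
      have arg: "s *\<^sub>R inv_into sl2 psi (u A) + r s = sl2_of (W s)"
        using sl2_of_psi[OF elim(1)] by (simp add: W_def sl2_of_linear)
      have "sgn a = 1 \<or> sgn a = -1" using a1 by (auto simp: sgn_if)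
      then have abs: "\<bar>T s\<bar> = sgn a * T s" using elim(2) by auto
      have "ell (M ** matrix_exp (sl2_of (W s))) = 2 * arcosh (\<bar>T s\<bar> / 2)"
        unfolding T_def
        by (rule ell_trace)
          (use lift elim(2) abs in \<open>simp_all add: det_mul det_matrix_exp_sl2_of is_lift_def T_def\<close>)
      then show ?case unfolding length_fun_def arg abs .
    qed
  qed
  have "((\<lambda>s. 2 * arcosh (sgn a * T s / 2)) has_real_derivative
      2 * (1 / sqrt ((sgn a * T 0 / 2)\<^sup>2 - 1) * (sgn a * trace (M ** sl2_of (u A)) / 2))) (at 0)"
  proof (intro DERIV_cmult DERIV_chain2[of arcosh])
    have "sgn a * T 0 / 2 > 1" using a1 by (simp add: T0 abs_sgn mult.commute)
    then show "(arcosh has_real_derivative 1 / sqrt ((sgn a * T 0 / 2)\<^sup>2 - 1)) (at (sgn a * T 0 / 2))"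
      by (rule arcosh_real_has_field_derivative)
    show "((\<lambda>s. sgn a * T s / 2) has_real_derivative sgn a * trace (M ** sl2_of (u A)) / 2) (at 0)"
      by (intro DERIV_cdivide DERIV_cmult T')
  qed
  also have "2 * (1 / sqrt ((sgn a * T 0 / 2)\<^sup>2 - 1) * (sgn a * trace (M ** sl2_of (u A)) / 2)) = 2 * margulis u A"
  proof -
    have "sgn a * T 0 / 2 = \<bar>a\<bar>" by (simp add: T0 abs_sgn mult.commute)
    then have "sqrt ((sgn a * T 0 / 2)\<^sup>2 - 1) = \<bar>d\<bar>" using ad(1) by (simp add: real_sqrt_abs[symmetric] del: real_sqrt_abs)
    moreover have "sgn a * d = \<bar>d\<bar>" "d \<noteq> 0"
      using ad(2) by (auto simp: zero_less_mult_iff)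
    ultimately show ?thesis by (simp add: trM margulis_def z B_commute[of z] field_simps)
  qed
  finally show ?thesis
    using DERIV_cong_ev[OF HOL.refl len HOL.refl] by blast
qed

section \<open>The derivative along affine twists\<close>

theorem theorem1p2:
  fixes b l :: nat
    and g :: "nat \<Rightarrow> real^3^3"
    and R :: "nat \<Rightarrow> (real^3) set"
    and f C C' :: "real^3^3"
    and x y :: "real^3"
    and \<theta> \<theta>' :: real
    and \<alpha> \<beta> t :: "nat \<Rightarrow> real"
    and u u0 :: "real^3^3 \<Rightarrow> real^3"
    and AT :: "nat \<Rightarrow> real^3^3 \<Rightarrow> real^3"
    and M :: "real^2^2"
    and r :: "real \<Rightarrow> real^2^2"
  assumes b: "b \<ge> 3"
    and G: "surface_group b g"
    and pants: "pants_decomposition b g R"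
    and l: "l \<in> {1..b-2}"
    \<comment> \<open>the curve \<open>f\<close> and its two intersection points, the orbits of \<open>x\<close> and \<open>y\<close>, with \<open>h\<^sub>l\<close>\<close>
    and f: "f \<in> Gb b g" "simple_closed_geodesic (Gb b g) f"
    and disjoint: "\<And>k. k \<in> {1..b-2} \<Longrightarrow> k \<noteq> l \<Longrightarrow>
          closed_geodesic (Gb b g) f \<inter> closed_geodesic (Gb b g) (hcurve g k) = {}"
    and twice: "closed_geodesic (Gb b g) f \<inter> closed_geodesic (Gb b g) (hcurve g l)
          = {orbit (Gb b g) x, orbit (Gb b g) y}" "orbit (Gb b g) x \<noteq> orbit (Gb b g) y"
    and x: "passes_at (Gb b g) f (R l) (R (l+1)) x"
    and y: "passes_at (Gb b g) f (R (l+1)) (R l) y"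
    \<comment> \<open>the angles, computed on the lifts of \<open>h\<^sub>l\<close> through \<open>x\<close> and \<open>y\<close>\<close>
    and C: "C \<in> Gb b g" "x \<in> axis_of (C ** hcurve g l ** matrix_inv C)"
    and C': "C' \<in> Gb b g" "y \<in> axis_of (C' ** hcurve g l ** matrix_inv C')"
    and \<theta>: "\<theta> = axis_angle (C ** hcurve g l ** matrix_inv C) f x"
    and \<theta>': "\<theta>' = pi - axis_angle (C' ** hcurve g l ** matrix_inv C') f y"
    and u0: "L0_cocycle b g \<alpha> \<beta> u0"
    and AT: "\<And>k. k \<in> {1..b-2} \<Longrightarrow> affine_twist b g k (AT k)"
    and u: "\<And>A. A \<in> Gb b g \<Longrightarrow> u A = u0 A + (\<Sum>k=1..b-2. t k *\<^sub>R AT k A)"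
    and lift: "is_lift M f"
    and r: "\<forall>\<^sub>F s in nhds 0. r s \<in> sl2" "(\<lambda>s. norm (r s)) \<in> O[nhds 0](\<lambda>s. s\<^sup>2)"
  shows "\<exists>D. (length_fun u f M r has_real_derivative D) (at 0) \<and>
           1 / 2 * D = margulis u0 f + t l * (cos \<theta> + cos \<theta>')"
proof -
  interpret decomposed_surface b g R
    using b G pants by (rule decomposed_surface.intro)
  have hyp: "hyperbolic f" using f(2) by (simp add: simple_closed_geodesic_def)
  obtain c m p where fr: "eigenframe f c m p (Xzero f)"
    using Xzero_eigenframe[OF hyp] .
  obtain ch mh ph where frh: "eigenframe (hcurve g l) ch mh ph (Xzero (hcurve g l))"
    using hcurve_eigenframe[OF l] .
  obtain F p' q' where fac: "F \<in> Gb b g" "F *v Xzero f = Xzero f"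
    "p' \<in> pants_group b g l" "q' \<in> pants_group b g (l+1)"
    "f ** C = (F ** C') ** p'" "C = (F ** C') ** q'"
    using two_crossings_factorization[OF l f disjoint twice x y C C'] .
  let ?Y = "Xzero (hcurve g l)"
  have angle: "cos \<theta> = B (C *v ?Y) (Xzero f)"
    unfolding \<theta> using x C
    by (intro cos_axis_angle[OF eigenframe_conj[OF frh iso] fr]) (auto simp: passes_at_def)
  have angle': "cos \<theta>' = - B (C' *v ?Y) (Xzero f)"
  proof -
    have "cos (axis_angle (C' ** hcurve g l ** matrix_inv C') f y) = B (C' *v ?Y) (Xzero f)"
      using y C' by (intro cos_axis_angle[OF eigenframe_conj[OF frh iso] fr]) (auto simp: passes_at_def)
    then show ?thesis unfolding \<theta>' by (simp add: cos_diff)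
  qed
  have twist: "margulis (AT k) f = (if k = l then cos \<theta> + cos \<theta>' else 0)" if "k \<in> {1..b-2}" for k
    using margulis_affine_twist[OF l that AT[OF that] f(1) eigenframeD(5)[OF fr] fac(1,2) C(1) C'(1) fac(3-6)]
    by (simp add: angle angle')
  have "margulis u f = margulis u0 f + (\<Sum>k=1..b-2. t k * margulis (AT k) f)"
  proof -
    have "B (\<Sum>k\<in>K. v k) w = (\<Sum>k\<in>K. B (v k) w)" if "finite K" for K :: "nat set" and v w
      using that by (induction K rule: finite_induct) auto
    then show ?thesis by (simp add: margulis_def u[OF f(1)])
  qed
  also have "(\<Sum>k=1..b-2. t k * margulis (AT k) f) = (\<Sum>k=1..b-2. if k = l then t l * (cos \<theta> + cos \<theta>') else 0)"
    by (intro sum.cong) (auto simp: twist)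
  also have "\<dots> = t l * (cos \<theta> + cos \<theta>')"
    using l by simp
  finally have "1 / 2 * (2 * margulis u f) = margulis u0 f + t l * (cos \<theta> + cos \<theta>')" by simp
  with length_fun_derivative[OF hyp lift r] show ?thesis by blast
qed

end
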